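(* Let $D\subset\mathbb{C}$ be a domain and let $L$ be a straight line which divides $D$ into two subdomains $D^+$ and $D^-$ (that is, $D\setminus L$ is the disjoint union of the two domains $D^+$ and $D^-$, which lie on different sides of $L$). Let $\mathcal{F}$ be a family of functions holomorphic in $D$ which do not have zeros in $D$ and for which all $1$-points lie on $L$. Suppose that $\mathcal{F}$ is not normal at $z_0\in D\cap L$ and let $(f_k)$ be a sequence in $\mathcal{F}$ which does not have a subsequence converging in any neighborhood of $z_0$. Suppose that $(f_k|_{D^+})$ converges. Then either $f_k|_{D^+}\to 0$ and $f_k|_{D^-}\to\infty$, or $f_k|_{D^+}\to\infty$ and $f_k|_{D^-}\to 0$.
   Context: A $1$-point of $f$ is a point $z$ in the domain of $f$ with $f(z)=1$. Convergence of a sequence of holomorphic functions in an open set means locally uniform convergence there with respect to the spherical metric (the constant limit $\infty$ is allowed). A family is normal in an open set $U$ if every sequence in it has a subsequence convergent in $U$ in this sense; it is normal at a point $z_0$ if it is normal in some neighborhood of $z_0$. *)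

theory Defs
  imports "HOL-Complex_Analysis.Complex_Analysis"
begin

definition plane_domain :: "complex set \<Rightarrow> bool" where
  "plane_domain D \<longleftrightarrow> open D \<and> connected D \<and> D \<noteq> {}"

text \<open>The Riemann sphere is represented by \<^typ>\<open>complex option\<close>, with \<^const>\<open>None\<close> as the point at
  infinity (as in the library's Alexandroff compactification). It is identified with the unit
  sphere of \<open>\<complex> \<times> \<real>\<close> by inverse stereographic projection from the north pole.\<close>

fun stereo :: "complex option \<Rightarrow> complex \<times> real" where
  "stereo (Some z) =
     ((2 / (1 + (cmod z)\<^sup>2)) *\<^sub>R z, ((cmod z)\<^sup>2 - 1) / ((cmod z)\<^sup>2 + 1))"
| "stereo None = (0, 1)"

text \<open>The length of the shorter great-circle arc, i.e. the angle between the two unit vectors.\<close>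

definition spherical_dist :: "complex option \<Rightarrow> complex option \<Rightarrow> real" where
  "spherical_dist p q = arccos (stereo p \<bullet> stereo q)"

text \<open>The limit is an arbitrary sphere-valued function. When the \<open>f k\<close> are holomorphic on \<open>U\<close>, it is
  automatically holomorphic or constantly infinite on each connected component of \<open>U\<close>.\<close>

definition sph_converges_to ::
    "(nat \<Rightarrow> complex \<Rightarrow> complex) \<Rightarrow> complex set \<Rightarrow> (complex \<Rightarrow> complex option) \<Rightarrow> bool" where
  "sph_converges_to f U g \<longleftrightarrow>
     (\<forall>z\<in>U. \<exists>r>0. ball z r \<subseteq> U \<and>
        (\<forall>e>0. \<forall>\<^sub>F k in sequentially. \<forall>w\<in>ball z r. spherical_dist (Some (f k w)) (g w) < e))"

definition sph_convergent :: "(nat \<Rightarrow> complex \<Rightarrow> complex) \<Rightarrow> complex set \<Rightarrow> bool" where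
  "sph_convergent f U \<longleftrightarrow> (\<exists>g. sph_converges_to f U g)"

definition normal_in :: "(complex \<Rightarrow> complex) set \<Rightarrow> complex set \<Rightarrow> bool" where
  "normal_in F U \<longleftrightarrow>
     (\<forall>f :: nat \<Rightarrow> complex \<Rightarrow> complex. (\<forall>k. f k \<in> F) \<longrightarrow> (\<exists>r :: nat \<Rightarrow> nat. strict_mono r \<and> sph_convergent (f \<circ> r) U))"

text \<open>The functions are total in HOL but only meaningful on the domain \<open>D\<close>, so neighbourhoods are
  taken inside \<open>D\<close>.\<close>

definition normal_at :: "complex set \<Rightarrow> (complex \<Rightarrow> complex) set \<Rightarrow> complex \<Rightarrow> bool" where
  "normal_at D F z0 \<longleftrightarrow> (\<exists>U. open U \<and> z0 \<in> U \<and> U \<subseteq> D \<and> normal_in F U)"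

end

theory Submission
  imports Defs
begin

text \<open>By Schottky's theorem, applied to \<open>f\<close>, \<open>1/f\<close> and their fractional powers, \<open>1 + \<bar>log \<bar>f\<bar>\<bar>\<close> satisfies a
  Harnack inequality wherever \<open>f\<close> omits 0 and 1. A chain of discs turns it into a polynomial bound in
  the inverse distance to the line, and a maximum principle argument then bounds \<open>f'/f\<close> across the
  line by \<open>M = 2 + \<bar>log \<bar>f p\<bar>\<bar> + \<bar>log \<bar>f q\<bar>\<bar>\<close>, with \<open>p\<close> and \<open>q\<close> on the two sides. If \<open>M\<^sub>k\<close> is bounded
  along a subsequence, Montel's theorem contradicts the choice of \<open>z\<^sub>0\<close>. Otherwise \<open>log \<bar>f\<^sub>k\<bar> / M\<^sub>k\<close>
  subconverges to a harmonic \<open>u \<noteq> 0\<close> near \<open>z\<^sub>0\<close>. If \<open>u\<close> did not change sign, \<open>f\<^sub>k\<close> would tend to 0 or \<open>\<infinity>\<close>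
  near \<open>z\<^sub>0\<close>. So \<open>u\<close> changes sign, and \<open>f\<^sub>k\<close> tends to 0 at some point off the line and to \<open>\<infinity>\<close> at
  another; by Schottky's theorem either behaviour spreads over the whole side on which it occurs.\<close>

section \<open>Schottky-type bounds for functions omitting 0 and 1\<close>

definition omits01_on :: "(complex \<Rightarrow> complex) \<Rightarrow> complex set \<Rightarrow> bool" where
  "omits01_on f S \<longleftrightarrow> f holomorphic_on S \<and> (\<forall>z\<in>S. f z \<noteq> 0 \<and> f z \<noteq> 1)"

lemma omits01_on_subset: "omits01_on f T \<Longrightarrow> S \<subseteq> T \<Longrightarrow> omits01_on f S"
  unfolding omits01_on_def by (meson holomorphic_on_subset subset_iff)

lemma omits01_on_inverse: "omits01_on f S \<Longrightarrow> omits01_on (\<lambda>z. inverse (f z)) S"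
  unfolding omits01_on_def by (auto intro!: holomorphic_intros)

text \<open>The bound of \<open>Schottky\<close> at \<open>t = 1/2\<close>: there
  \<open>12 * t / (1 - t) = 12\<close>, and the remaining 2 makes 14.\<close>

definition schottky_bound :: "real \<Rightarrow> real" where
  "schottky_bound M = exp (pi * exp (pi * (14 + 2 * M)))"

lemma schottky_bound_pos: "schottky_bound M > 0"
  by (simp add: schottky_bound_def)

lemma schottky_ball:
  assumes "omits01_on f (ball p R)" "0 < R" "cmod (f p) \<le> M" "dist p z \<le> R / 4"
  shows "cmod (f z) \<le> schottky_bound M"
proof -
  \<comment> \<open>The closed unit disc is mapped onto \<open>cball p (R / 2)\<close>, a closed
    disc inside the domain. The hypothesis \<open>dist p z \<le> R / 4\<close> then becomes
    \<open>cmod w \<le> 1 / 2\<close>.\<close>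
  define g where "g = (\<lambda>w. f (p + of_real (R / 2) * w))"
  define w where "w = of_real (2 / R) * (z - p)"
  have img: "p + of_real (R / 2) * w \<in> ball p R" if "w \<in> cball 0 1" for w
  proof -
    have "cmod (of_real (R / 2) * w) \<le> R / 2 * 1"
      unfolding norm_mult using that assms(2) by (intro mult_mono) auto
    also have "\<dots> < R"
      using assms(2) by simp
    finally show ?thesis
      by (simp add: dist_norm norm_minus_commute)
  qed
  have hol: "g holomorphic_on cball 0 1"
    unfolding g_def
    by (rule holomorphic_on_compose_gen[unfolded o_def, where g = f and t = "ball p R"])
       (use assms(1) img in \<open>auto intro!: holomorphic_intros simp: omits01_on_def\<close>)
  have "cmod (g w) \<le> exp (pi * exp (pi * (2 + 2 * M + 12 * (1/2) / (1 - 1/2))))"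
  proof (rule Schottky[OF hol])
    show "cmod (g 0) \<le> M"
      using assms(3) by (simp add: g_def)
    show "\<not> (g z = 0 \<or> g z = 1)" if "z \<in> cball 0 1" for z
      using assms(1) img[OF that] by (auto simp: g_def omits01_on_def)
    show "cmod w \<le> 1 / 2"
      using assms(2,4) unfolding w_def norm_mult norm_of_real
      by (simp add: dist_norm norm_minus_commute field_simps)
  qed auto
  also have "of_real (R / 2) * w = z - p"
    unfolding w_def mult.assoc[symmetric] of_real_mult[symmetric] using assms(2) by simp
  then have "p + of_real (R / 2) * w = z"
    by (metis add.commute diff_add_cancel)
  then have "g w = f z"
    by (simp only: g_def)
  finally show ?thesis
    by (simp add: schottky_bound_def algebra_simps)
qed

section \<open>A Harnack inequality for the size of log |f|\<close>

definition logsize :: "(complex \<Rightarrow> complex) \<Rightarrow> complex \<Rightarrow> real" where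
  "logsize f z = 1 + \<bar>ln (cmod (f z))\<bar>"

lemma logsize_ge_1: "logsize f z \<ge> 1"
  by (simp add: logsize_def)

lemma logsize_inverse: "logsize (\<lambda>z. inverse (f z)) z = logsize f z"
  \<comment> \<open>A zero of \<open>f\<close> causes no trouble, because
    \<open>inverse 0 = 0\<close> makes both sides equal.\<close>
  by (cases "f z = 0") (auto simp: logsize_def norm_inverse ln_inverse)

text \<open>The second summand is \<open>ln (schottky_bound (exp 1))\<close>. The first pays for the
  1 in \<open>logsize\<close>, which is there because |ln |f|| alone can vanish at one point and not
  at its neighbours.\<close>

definition harnack_const :: real where
  "harnack_const = 1 + pi * exp (pi * (14 + 2 * exp 1))"

lemma harnack_const_ge_1: "harnack_const \<ge> 1"
  by (simp add: harnack_const_def)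

text \<open>If \<open>\<bar>f\<bar>\<close> exceeds 1 near \<open>p\<close>, Schottky's theorem is applied to a fractional power of \<open>f\<close> whose
  value at \<open>p\<close> is bounded; this makes the bound linear in \<open>ln \<bar>f p\<bar>\<close>.\<close>

lemma ln_cmod_le_logsize:
  assumes f: "omits01_on f (ball p R)" and R: "0 < R" and z: "dist p z \<le> R / 64"
  shows "ln (cmod (f z)) \<le> (harnack_const - 1) * logsize f p"
proof (cases "\<exists>w\<in>ball p (R / 16). cmod (f w) \<le> 1")
  \<comment> \<open>If |f| is at most 1 somewhere near \<open>p\<close>, Schottky's theorem centred
    at that point gives an absolute bound, independent of \<open>f p\<close>.\<close>
  case True
  then obtain w where w: "dist p w < R / 16" "cmod (f w) \<le> 1"
    by auto
  have "ball w (R / 2) \<subseteq> ball p R"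
  proof
    fix x assume "x \<in> ball w (R / 2)"
    then show "x \<in> ball p R"
      using dist_triangle[of p x w] w(1) R by simp
  qed
  then have "omits01_on f (ball w (R / 2))"
    using f omits01_on_subset by blast
  moreover have "dist w z \<le> (R / 2) / 4"
    using dist_triangle[of w z p] w(1) z R by (simp add: dist_commute)
  ultimately have "cmod (f z) \<le> schottky_bound 1"
    using w(2) R by (intro schottky_ball[of f w "R / 2"]) auto
  moreover have "f z \<noteq> 0"
    using f z R by (auto simp: omits01_on_def)
  ultimately have "ln (cmod (f z)) \<le> ln (schottky_bound 1)"
    by (simp add: schottky_bound_pos)
  also have "\<dots> \<le> harnack_const - 1"
    by (simp add: schottky_bound_def harnack_const_def)
  also have "\<dots> \<le> (harnack_const - 1) * logsize f p"
    using logsize_ge_1[of f p] harnack_const_ge_1 mult_left_mono[of 1 "logsize f p" "harnack_const - 1"]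
    by simp
  finally show ?thesis .
next
  case False
  then have gt: "cmod (f w) > 1" if "w \<in> ball p (R / 16)" for w
    using that by force
  have sub: "ball p (R / 16) \<subseteq> ball p R"
    using R by auto
  have f': "omits01_on f (ball p (R / 16))"
    using f sub omits01_on_subset by blast
  obtain h where h: "h holomorphic_on ball p (R / 16)" "\<And>w. w \<in> ball p (R / 16) \<Longrightarrow> f w = exp (h w)"
    using f' R convex_ball[of p "R / 16"] 
    by (metis holomorphic_logarithm_exists omits01_on_def open_ball centre_in_ball zero_less_divide_iff zero_less_numeral)
  have Re_h: "Re (h w) = ln (cmod (f w))" if "w \<in> ball p (R / 16)" for w
    using h(2)[OF that] by simp
  define t where "t = logsize f p"
  have t: "t \<ge> 1" "ln (cmod (f p)) \<le> t"
    by (auto simp: t_def logsize_def)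
  \<comment> \<open>\<open>F\<close> is a branch of f^(1/t). Its modulus at \<open>p\<close> is at
    most e since \<open>ln (cmod (f p)) \<le> t\<close>, and it omits 1 because |f| > 1 throughout
    the disc. Schottky's theorem on \<open>ball p (R / 16)\<close> reaches as far as R/64, which is
    where the constant 64 comes from.\<close>
  define F where "F = (\<lambda>w. exp (h w / of_real t))"
  have nF: "cmod (F w) = exp (ln (cmod (f w)) / t)" if "w \<in> ball p (R / 16)" for w
    using Re_h[OF that] t by (simp add: F_def)
  have "omits01_on F (ball p (R / 16))"
    unfolding omits01_on_def
  proof safe
    show "F holomorphic_on ball p (R / 16)"
      unfolding F_def using t by (intro holomorphic_intros h) auto
  next
    fix w assume w: "w \<in> ball p (R / 16)" 
    {
      assume "F w = 1"
      then have "exp (ln (cmod (f w)) / t) = 1"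
        using nF[OF w] by simp
      then show False
        using gt[OF w] t ln_gt_zero[OF gt[OF w]] by simp
    }
    {
      assume "F w = 0"
      then show False
        by (simp add: F_def)
    }
  qed
  then have "cmod (F z) \<le> schottky_bound (exp 1)"
  proof (rule schottky_ball)
    show "cmod (F p) \<le> exp 1"
      using nF[of p] R t by (simp add: divide_simps)
  qed (use R z in auto)
  moreover have zin: "z \<in> ball p (R / 16)"
    using z R by simp
  ultimately have "ln (cmod (f z)) / t \<le> harnack_const - 1"
    using nF[OF zin] by (simp add: schottky_bound_def harnack_const_def)
  then show ?thesis
    using t by (simp add: t_def[symmetric] divide_simps)
qed

text \<open>The preceding estimate bounds ln |f| only from above. Applied to 1/f, which also omits 0
  and 1, it gives the bound from below.\<close>

lemma logsize_harnack:
  assumes f: "omits01_on f (ball p R)" and R: "0 < R" and z: "dist p z \<le> R / 64"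
  shows "logsize f z \<le> harnack_const * logsize f p"
proof -
  have "ln (cmod (f z)) \<le> (harnack_const - 1) * logsize f p"
    by (rule ln_cmod_le_logsize[OF assms])
  moreover have "ln (cmod (inverse (f z))) \<le> (harnack_const - 1) * logsize f p"
    using ln_cmod_le_logsize[OF omits01_on_inverse[OF f] R z] by (simp add: logsize_inverse)
  moreover have "f z \<noteq> 0"
    using f z R by (auto simp: omits01_on_def)
  ultimately have "\<bar>ln (cmod (f z))\<bar> \<le> (harnack_const - 1) * logsize f p"
    by (simp add: norm_inverse ln_inverse)
  then show ?thesis
    using logsize_ge_1[of f p] unfolding logsize_def[of f z] by (simp add: algebra_simps)
qed

text \<open>The Harnack inequality is iterated along the segment in \<open>n\<close> equal steps of
  length at most R/64, each step costing one factor \<open>harnack_const\<close>.\<close>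

lemma logsize_chain:
  assumes f: "omits01_on f S" and R: "0 < R"
    and sub: "\<And>q. q \<in> closed_segment p z \<Longrightarrow> ball q R \<subseteq> S"
    and "dist p z \<le> real n * (R / 64)"
  shows "logsize f z \<le> harnack_const ^ n * logsize f p"
  using sub assms(4)
proof (induction n arbitrary: z)
  case 0
  then show ?case by simp
next
  case (Suc n)
  \<comment> \<open>\<open>w\<close> is the last but one of the equally spaced points on the
    segment, so the induction hypothesis covers the way from \<open>p\<close> to \<open>w\<close>
    and a single step remains.\<close>
  define c where "c = real n / real (Suc n)"
  have c: "0 \<le> c" "c \<le> 1" "1 - c = 1 / real (Suc n)"
    by (auto simp: c_def field_simps)
  define w where "w = p + c *\<^sub>R (z - p)"
  have w_seg: "w \<in> closed_segment p z"
    unfolding in_segment w_def using c by (intro exI[of _ c]) (simp add: algebra_simps)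
  have "p - w = c *\<^sub>R (p - z)" "w - z = (1 - c) *\<^sub>R (p - z)"
    by (simp_all add: w_def algebra_simps)
  then have d1: "dist p w = c * dist p z" and d2: "dist w z = 1 / real (Suc n) * dist p z"
    using c by (simp_all add: dist_norm)
  have "logsize f w \<le> harnack_const ^ n * logsize f p"
  proof (rule Suc.IH)
    show "ball q R \<subseteq> S" if "q \<in> closed_segment p w" for q
      using that w_seg Suc.prems(1) subset_closed_segment[of p w p z] by blast
    show "dist p w \<le> real n * (R / 64)"
      unfolding d1 using Suc.prems(2) mult_left_mono[OF Suc.prems(2), of c] c(1) by (simp add: c_def)
  qed
  moreover have "logsize f z \<le> harnack_const * logsize f w"
  proof (rule logsize_harnack[OF _ R])
    show "omits01_on f (ball w R)"
      using f Suc.prems(1)[OF w_seg] omits01_on_subset by blast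
    show "dist w z \<le> R / 64"
      unfolding d2 using Suc.prems(2) by (simp add: field_simps)
  qed
  ultimately show ?case
    using mult_left_mono[of "logsize f w" "harnack_const ^ n * logsize f p" harnack_const]
      harnack_const_ge_1 by (smt (verit) mult.assoc power_Suc)
qed

section \<open>The logarithmic derivative near the line\<close>

definition upper_box :: "complex set" where
  "upper_box = {z. \<bar>Re z\<bar> \<le> 1 \<and> 0 < Im z \<and> Im z \<le> 1}"

lemma ball_upper_box:
  assumes "z \<in> upper_box" "R \<le> Im z"
  shows "ball z R \<subseteq> ball 0 4 \<inter> {z. Im z > 0}"
proof
  fix q assume q: "q \<in> ball z R"
  have "\<bar>Im (z - q)\<bar> < R"
    using q abs_Im_le_cmod[of "z - q"] by (simp add: dist_norm)
  moreover have "cmod q \<le> cmod z + cmod (z - q)"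
    by (metis norm_minus_commute norm_triangle_sub)
  moreover have "cmod z \<le> \<bar>Re z\<bar> + \<bar>Im z\<bar>"
    by (rule cmod_le)
  ultimately show "q \<in> ball 0 4 \<inter> {z. Im z > 0}"
    using q assms by (auto simp: upper_box_def dist_norm)
qed

text \<open>Points of height at least 1/4 are centres of admissible discs of radius 1/4. One step
  then has length 1/256, and 768 steps cover a distance of 3, which exceeds any distance needed
  here.\<close>

lemma logsize_upper_box_base:
  assumes f: "omits01_on f (ball 0 4 \<inter> {z. Im z > 0})"
    and z: "z \<in> upper_box" "1/4 \<le> Im z"
  shows "logsize f z \<le> harnack_const ^ 768 * logsize f (\<i> / 4)"
proof (rule logsize_chain[OF f])
  let ?S = "{z. Re z \<ge> -1} \<inter> {z. Re z \<le> 1} \<inter> {z. Im z \<ge> 1/4} \<inter> {z. Im z \<le> 1}"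
  have "convex ?S"
    by (intro convex_Int convex_halfspace_Re_ge convex_halfspace_Re_le convex_halfspace_Im_ge
        convex_halfspace_Im_le)
  then have seg: "closed_segment (\<i> / 4) z \<subseteq> ?S"
    by (rule closed_segment_subset[rotated 2]) (use z in \<open>auto simp: upper_box_def\<close>)
  show "ball q (1/4) \<subseteq> ball 0 4 \<inter> {z. Im z > 0}" if "q \<in> closed_segment (\<i> / 4) z" for q
    by (rule ball_upper_box) (use subsetD[OF seg that] in \<open>auto simp: upper_box_def\<close>)
  have "cmod (\<i> / 4 - z) \<le> \<bar>Re (\<i> / 4 - z)\<bar> + \<bar>Im (\<i> / 4 - z)\<bar>"
    by (rule cmod_le)
  also have "\<dots> \<le> 3"
    using z by (auto simp: upper_box_def)
  finally show "dist (\<i> / 4) z \<le> real 768 * (1 / 4 / 64)"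
    by (simp add: dist_norm)
qed auto

text \<open>Near the line the discs must shrink with the height, so the chain climbs vertically with
  heights growing by the factor 65/64. A point of height at least \<open>(64/65) ^ n / 4\<close>
  gets to height 1/4 in at most \<open>n\<close> steps.\<close>

lemma logsize_upper_box_chain:
  assumes f: "omits01_on f (ball 0 4 \<inter> {z. Im z > 0})"
    and A: "A \<ge> 0" "\<And>z. z \<in> upper_box \<Longrightarrow> 1/4 \<le> Im z \<Longrightarrow> logsize f z \<le> A"
    and z: "z \<in> upper_box" "(64/65) ^ n / 4 \<le> Im z"
  shows "logsize f z \<le> harnack_const ^ n * A"
  using z
proof (induction n arbitrary: z)
  case 0
  then show ?case using A by simp
next
  case (Suc n)
  show ?case
  proof (cases "Im z \<ge> 1/4")
    case True
    then have "logsize f z \<le> 1 * A"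
      using A Suc.prems(1) by simp
    also have "\<dots> \<le> harnack_const ^ Suc n * A"
      using A(1) one_le_power[OF harnack_const_ge_1] by (rule mult_right_mono[rotated])
    finally show ?thesis .
  next
    case False
    \<comment> \<open>The Harnack disc is centred at the upper point \<open>w\<close> and has radius
      \<open>Im w\<close>, so a vertical move of \<open>Im z / 64\<close> is within its
      range.\<close>
    define w where "w = z + \<i> * of_real (Im z / 64)"
    have w: "w \<in> upper_box" "Im w = 65/64 * Im z"
      using False Suc.prems(1) by (auto simp: w_def upper_box_def)
    have "logsize f z \<le> harnack_const * logsize f w"
    proof (rule logsize_harnack)
      show "omits01_on f (ball w (Im w))"
        using ball_upper_box[OF w(1)] f omits01_on_subset by blast
      have "dist w z = cmod (\<i> * of_real (Im z / 64))"
        by (simp add: dist_norm w_def)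
      also have "\<dots> = Im z / 64"
        using Suc.prems(1) by (simp add: norm_mult upper_box_def)
      also have "\<dots> \<le> Im w / 64"
        using Suc.prems(1) by (simp add: w upper_box_def)
      finally show "dist w z \<le> Im w / 64" .
    qed (use w in \<open>auto simp: upper_box_def\<close>)
    also have "\<dots> \<le> harnack_const * (harnack_const ^ n * A)"
      using w Suc.prems(2) harnack_const_ge_1 by (intro mult_left_mono Suc.IH) auto
    also have "\<dots> = harnack_const ^ Suc n * A"
      by (simp add: mult.assoc)
    finally show ?thesis .
  qed
qed

text \<open>The number of steps grows only like log (1 / Im z), so a fixed factor per step amounts
  to a fixed power of 1 / Im z. The exponent \<open>N\<close> is chosen so that (65/64)^N exceeds
  the factor per step.\<close>

lemma logsize_upper_box:
  "\<exists>K\<ge>1. \<exists>N. \<forall>f. \<forall>z\<in>upper_box. omits01_on f (ball 0 4 \<inter> {z. Im z > 0}) \<longrightarrow>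
     logsize f z * Im z ^ N \<le> K * logsize f (\<i> / 4)"
proof -
  obtain N :: nat where N: "harnack_const < (65/64) ^ N"
    using real_arch_pow[of "65/64" harnack_const] by auto
  define K where "K = harnack_const ^ 768"
  have K: "K \<ge> 1"
    unfolding K_def using harnack_const_ge_1 by (rule one_le_power)
  have "logsize f z * Im z ^ N \<le> K * logsize f (\<i> / 4)"
    if f: "omits01_on f (ball 0 4 \<inter> {z. Im z > 0})" and z: "z \<in> upper_box" for f z
  proof -
    have z': "0 < Im z" "Im z \<le> 1"
      using z by (auto simp: upper_box_def)
    obtain m where "(64/65) ^ m < 4 * Im z"
      using real_arch_pow_inv[of "4 * Im z" "64/65"] z' by auto
    then have ex: "\<exists>n. (64/65) ^ n / 4 \<le> Im z"
      by (intro exI[of _ m]) simp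
    \<comment> \<open>Minimality makes \<open>(64/65) ^ n\<close> an upper bound for
      \<open>Im z\<close>, so that \<open>Im z ^ N\<close> cancels the accumulated Harnack
      factors.\<close>
    define n where "n = (LEAST n. (64/65) ^ n / 4 \<le> Im z)"
    have n: "(64/65) ^ n / 4 \<le> Im z"
      unfolding n_def using ex by (rule LeastI_ex)
    have *: "harnack_const ^ n * Im z ^ N \<le> 1"
    proof (cases n)
      case 0
      then show ?thesis using z' by (simp add: power_le_one)
    next
      case (Suc m)
      have "Im z < (64/65) ^ m / 4"
        using not_less_Least[of m "\<lambda>n. (64/65) ^ n / 4 \<le> Im z"] Suc by (simp add: n_def)
      \<comment> \<open>The factor 1/4 absorbs the passage from exponent \<open>m\<close> to
        \<open>n = Suc m\<close>.\<close>
      also have "\<dots> \<le> (64/65) ^ n"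
        by (simp add: Suc)
      finally have "Im z ^ N \<le> ((64/65) ^ n) ^ N"
        using z' by (intro power_mono) auto
      moreover have "harnack_const ^ n \<le> ((65/64) ^ N) ^ n"
        using N harnack_const_ge_1 by (intro power_mono) auto
      ultimately have "harnack_const ^ n * Im z ^ N \<le> ((65/64) ^ N) ^ n * ((64/65) ^ n) ^ N"
        using z' harnack_const_ge_1 by (intro mult_mono) auto
      also have "\<dots> = (65/64 * (64/65)) ^ (N * n)"
        by (simp only: power_mult_distrib power_mult[symmetric] mult.commute[of n N])
      also have "\<dots> = 1"
        by simp
      finally show ?thesis .
    qed
    have K': "0 \<le> K * logsize f (\<i> / 4)"
      using K logsize_ge_1[of f "\<i> / 4"] by simp
    have "logsize f z \<le> harnack_const ^ n * (K * logsize f (\<i> / 4))"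
      using logsize_upper_box_base[OF f] z n K'
      unfolding K_def[symmetric] by (intro logsize_upper_box_chain[OF f]) auto
    then have "logsize f z * Im z ^ N \<le> harnack_const ^ n * (K * logsize f (\<i> / 4)) * Im z ^ N"
      using z' by (intro mult_right_mono) auto
    also have "\<dots> = (harnack_const ^ n * Im z ^ N) * (K * logsize f (\<i> / 4))"
      by (simp only: mult_ac)
    also have "\<dots> \<le> 1 * (K * logsize f (\<i> / 4))"
      using * K' by (rule mult_right_mono)
    finally show ?thesis by simp
  qed
  with K show ?thesis
    by (intro exI[of _ K] exI[of _ N] conjI allI ballI impI)
qed

lemma logsize_both_boxes:
  "\<exists>K\<ge>1. \<exists>N. \<forall>f z. omits01_on f (ball 0 4 - {z. Im z = 0}) \<longrightarrow>
     \<bar>Re z\<bar> \<le> 1 \<longrightarrow> \<bar>Im z\<bar> \<le> 1 \<longrightarrow> Im z \<noteq> 0 \<longrightarrow>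
     logsize f z * \<bar>Im z\<bar> ^ N \<le> K * (logsize f (\<i> / 4) + logsize f (- \<i> / 4))"
proof -
  obtain K N where NK: "K \<ge> 1" "\<forall>f. \<forall>z\<in>upper_box. omits01_on f (ball 0 4 \<inter> {z. Im z > 0}) \<longrightarrow>
      logsize f z * Im z ^ N \<le> K * logsize f (\<i> / 4)"
    using logsize_upper_box by (elim exE conjE)
  have "logsize f z * \<bar>Im z\<bar> ^ N \<le> K * (logsize f (\<i> / 4) + logsize f (- \<i> / 4))"
    if f: "omits01_on f (ball 0 4 - {z. Im z = 0})" and z: "\<bar>Re z\<bar> \<le> 1" "\<bar>Im z\<bar> \<le> 1" "Im z \<noteq> 0" for f z
  proof -
    have nonneg: "K * logsize f w \<ge> 0" for w
      using NK(1) logsize_ge_1[of f w] by simp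
    consider "Im z > 0" | "Im z < 0"
      using z(3) by linarith
    then show ?thesis
    proof cases
      case 1
      have "omits01_on f (ball 0 4 \<inter> {z. Im z > 0})"
        using f by (rule omits01_on_subset) auto
      moreover have "z \<in> upper_box"
        using z 1 by (simp add: upper_box_def)
      ultimately have "logsize f z * Im z ^ N \<le> K * logsize f (\<i> / 4)"
        using NK(2) by blast
      then show ?thesis
        using 1 nonneg[of "- \<i> / 4"] by (simp add: distrib_left)
    next
      \<comment> \<open>The lower half is brought to the upper one by z \<mapsto> -z, which keeps
        the composite holomorphic and exchanges the base points i/4 and -i/4.\<close>
      case 2
      have neg: "- z \<in> ball 0 4 - {z. Im z = 0}" if "z \<in> ball 0 4 \<inter> {z. Im z > 0}" for z :: complex
        using that by simp
      have "omits01_on (\<lambda>z. f (- z)) (ball 0 4 \<inter> {z. Im z > 0})"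
        unfolding omits01_on_def
      proof
        have "f holomorphic_on ball 0 4 - {z. Im z = 0}"
          using f by (simp add: omits01_on_def)
        then have "f \<circ> uminus holomorphic_on ball 0 4 \<inter> {z. Im z > 0}"
          using neg by (intro holomorphic_on_compose_gen[where t = "ball 0 4 - {z. Im z = 0}"]
              holomorphic_on_minus holomorphic_on_ident image_subsetI)
        then show "(\<lambda>z. f (- z)) holomorphic_on ball 0 4 \<inter> {z. Im z > 0}"
          by (simp add: o_def)
        show "\<forall>z\<in>ball 0 4 \<inter> {z. Im z > 0}. f (- z) \<noteq> 0 \<and> f (- z) \<noteq> 1"
          using f neg unfolding omits01_on_def by blast
      qed
      moreover have "- z \<in> upper_box"
        using z 2 by (simp add: upper_box_def)
      ultimately have "logsize (\<lambda>z. f (- z)) (- z) * Im (- z) ^ N \<le> K * logsize (\<lambda>z. f (- z)) (\<i> / 4)"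
        using NK(2) by blast
      then have "logsize f z * (- Im z) ^ N \<le> K * logsize f (- \<i> / 4)"
        by (simp add: logsize_def)
      then show ?thesis
        using 2 nonneg[of "\<i> / 4"] by (simp add: distrib_left)
    qed
  qed
  with NK(1) show ?thesis
    by (intro exI[of _ K] exI[of _ N] conjI allI ballI impI)
qed

section \<open>From log |f| to the logarithmic derivative\<close>

lemma deriv_bound_of_Re_bound:
  assumes h: "h holomorphic_on ball z s" and V: "V > 0" and t: "0 < t" "t < s"
    and bd: "\<And>q. dist z q \<le> t \<Longrightarrow> \<bar>Re (h q)\<bar> \<le> V"
  shows "cmod (deriv h z) \<le> exp 2 * V / t"
proof -
  \<comment> \<open>On the closed disc of radius \<open>t\<close> the modulus of \<open>F\<close>
    lies between 1/e and e. Cauchy's inequality bounds F' = F h' / V, and dividing by |F| \<ge> 1/e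
    gives the factor e^2.\<close>
  define F where "F = (\<lambda>q. exp (h q / of_real V))"
  have F_hol: "F holomorphic_on ball z s"
    unfolding F_def using V by (intro holomorphic_intros h) auto
  have cb: "cball z t \<subseteq> ball z s"
    using t by auto
  have "cmod ((deriv ^^ 1) F z) \<le> fact 1 * exp 1 / t ^ 1"
  proof (rule Cauchy_inequality)
    show "F holomorphic_on ball z t" "continuous_on (cball z t) F"
      using F_hol cb holomorphic_on_subset holomorphic_on_imp_continuous_on
      by (meson ball_subset_cball order_trans)+
    show "cmod (F q) \<le> exp 1" if "cmod (z - q) = t" for q
      using bd[of q] that V by (simp add: F_def dist_norm divide_simps)
  qed (use t in auto)
  moreover have "deriv F z = exp (h z / of_real V) * (deriv h z / of_real V)"
    unfolding F_def using t V holomorphic_derivI[OF h, of z]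
    by (intro DERIV_imp_deriv) (auto intro!: derivative_eq_intros)
  moreover have "exp (Re (h z) / V) \<ge> exp (-1)"
    using bd[of z] t V by (simp add: divide_simps)
  ultimately have "exp (-1) * (cmod (deriv h z) / V) \<le> exp 1 / t"
    using mult_right_mono[of "exp (-1)" "exp (Re (h z) / V)" "cmod (deriv h z) / V"] V
    by (simp add: norm_mult norm_divide)
  then have "exp 1 * (exp (-1) * (cmod (deriv h z) / V)) \<le> exp 1 * (exp 1 / t)"
    by (intro mult_left_mono) auto
  then show ?thesis
    using V t by (simp add: mult.assoc[symmetric] flip: exp_add) (simp add: field_simps)
qed

text \<open>The estimate blows up polynomially at the line. On the unit circle the factor \<open>z\<^sup>2 - 1\<close> has
  modulus \<open>2 \<bar>Im z\<bar>\<close>, so a power of it compensates and the maximum principle applies.\<close>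

lemma deriv_log_bound:
  "\<exists>K>0. \<forall>f h z. h holomorphic_on ball 0 4 \<longrightarrow> (\<forall>z\<in>ball 0 4. f z = exp (h z)) \<longrightarrow>
     (\<forall>z\<in>ball 0 4. f z = 1 \<longrightarrow> Im z = 0) \<longrightarrow> cmod z \<le> 1/2 \<longrightarrow>
     cmod (deriv h z) \<le> K * (logsize f (\<i> / 4) + logsize f (- \<i> / 4))"
proof -
  obtain K N where NK: "K \<ge> 1" "\<forall>f z. omits01_on f (ball 0 4 - {z. Im z = 0}) \<longrightarrow>
      \<bar>Re z\<bar> \<le> 1 \<longrightarrow> \<bar>Im z\<bar> \<le> 1 \<longrightarrow> Im z \<noteq> 0 \<longrightarrow>
      logsize f z * \<bar>Im z\<bar> ^ N \<le> K * (logsize f (\<i> / 4) + logsize f (- \<i> / 4))"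
    using logsize_both_boxes by (elim exE conjE)
  define K1 where "K1 = exp 2 * harnack_const * 64 * K"
  have K1: "K1 > 0"
    using NK(1) harnack_const_ge_1 by (simp add: K1_def)
  \<comment> \<open>The factor \<open>2 ^ (N + 1)\<close> comes from |w^2 - 1| = 2 |Im w| on the
    unit circle, and \<open>(4/3) ^ (N + 1)\<close> from |z^2 - 1| \<ge> 3/4 for |z| \<le>
    1/2.\<close>
  define K2 where "K2 = K1 * 2 ^ (N + 1) * (4/3) ^ (N + 1)"
  have "cmod (deriv h z) \<le> K2 * (logsize f (\<i> / 4) + logsize f (- \<i> / 4))"
    if h: "h holomorphic_on ball 0 4" and fh: "\<And>z. z \<in> ball 0 4 \<Longrightarrow> f z = exp (h z)"
      and one: "\<And>z. z \<in> ball 0 4 \<Longrightarrow> f z = 1 \<Longrightarrow> Im z = 0" and z: "cmod z \<le> 1/2" for f h z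
  proof -
    define V where "V = logsize f (\<i> / 4) + logsize f (- \<i> / 4)"
    have V: "V > 0"
      using logsize_ge_1[of f "\<i> / 4"] logsize_ge_1[of f "- \<i> / 4"] by (simp add: V_def)
    have f_hol: "f holomorphic_on ball 0 4"
      by (rule holomorphic_transform[of "\<lambda>z. exp (h z)"]) (use h fh in \<open>auto intro!: holomorphic_intros\<close>)
    have f: "omits01_on f (ball 0 4 - {z. Im z = 0})"
      unfolding omits01_on_def using holomorphic_on_subset[OF f_hol] fh one by auto
    have Re_h: "\<bar>Re (h q)\<bar> \<le> logsize f q" if "q \<in> ball 0 4" for q
      using fh[OF that] by (simp add: logsize_def)
    have circle: "cmod (deriv h w) * \<bar>Im w\<bar> ^ (N + 1) \<le> K1 * V" if w: "cmod w = 1" "Im w \<noteq> 0" for w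
    proof -
      define y where "y = \<bar>Im w\<bar>"
      have y: "0 < y" "y \<le> 1" "\<bar>Re w\<bar> \<le> 1"
        using w abs_Im_le_cmod[of w] abs_Re_le_cmod[of w] by (auto simp: y_def)
      have sub: "ball w y \<subseteq> ball 0 4 - {z. Im z = 0}"
      proof
        fix q assume q: "q \<in> ball w y"
        have "cmod (w - q) < y"
          using q by (simp add: dist_norm)
        then have "Im q \<noteq> 0"
          using abs_Im_le_cmod[of "w - q"] by (auto simp: y_def)
        moreover have "cmod q \<le> cmod w + cmod (w - q)"
          by (metis norm_minus_commute norm_triangle_sub)
        ultimately show "q \<in> ball 0 4 - {z. Im z = 0}"
          using q y w by (auto simp: dist_norm)
      qed
      define W where "W = harnack_const * logsize f w"
      have W: "W > 0"
        using harnack_const_ge_1 logsize_ge_1[of f w] by (simp add: W_def)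
      \<comment> \<open>On the disc of radius y/64 the Harnack inequality bounds |Re h| by
        \<open>W\<close>. Passing to the derivative costs a factor 64/y, which raises the exponent
        from \<open>N\<close> to \<open>N + 1\<close>.\<close>
      have "cmod (deriv h w) \<le> exp 2 * W / (y / 64)"
      proof (rule deriv_bound_of_Re_bound[where s = y])
        show "h holomorphic_on ball w y"
          using h sub holomorphic_on_subset by blast
        fix q assume q: "dist w q \<le> y / 64"
        then have "q \<in> ball w y"
          using y by simp
        then have "\<bar>Re (h q)\<bar> \<le> logsize f q"
          using sub Re_h by blast
        also have "\<dots> \<le> W"
          unfolding W_def using f sub omits01_on_subset y q by (intro logsize_harnack) blast+
        finally show "\<bar>Re (h q)\<bar> \<le> W" .
      qed (use y W in auto)
      then have "cmod (deriv h w) * y \<le> exp 2 * harnack_const * 64 * logsize f w"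
        using y by (simp add: W_def field_simps)
      then have "cmod (deriv h w) * y * y ^ N \<le> exp 2 * harnack_const * 64 * logsize f w * y ^ N"
        using y by (intro mult_right_mono) auto
      also have "\<dots> = exp 2 * harnack_const * 64 * (logsize f w * y ^ N)"
        by simp
      also have "\<dots> \<le> exp 2 * harnack_const * 64 * (K * V)"
        unfolding V_def y_def using f w y harnack_const_ge_1
        by (intro mult_left_mono NK(2)[rule_format]) (auto simp: y_def)
      finally show ?thesis
        by (simp add: y_def K1_def mult.assoc)
    qed
    have hd: "deriv h holomorphic_on ball 0 4"
      using h by (simp add: holomorphic_deriv)
    define g where "g = (\<lambda>w. deriv h w * (w\<^sup>2 - 1) ^ (N + 1))"
    have g_hol: "g holomorphic_on ball 0 4"
      unfolding g_def by (intro holomorphic_intros hd)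
    have "cmod (g z) \<le> K1 * V * 2 ^ (N + 1)"
    proof (rule maximum_modulus_frontier[of g "cball 0 1"])
      show "g holomorphic_on interior (cball 0 1)"
        by (rule holomorphic_on_subset[OF g_hol]) auto
      show "continuous_on (closure (cball 0 1)) g"
        by (rule continuous_on_subset[OF holomorphic_on_imp_continuous_on[OF g_hol]]) auto
      fix w assume "w \<in> frontier (cball (0::complex) 1)"
      then have w: "cmod w = 1"
        by (simp add: frontier_cball)
      then have "w * cnj w = 1"
        by (simp add: complex_norm_square[symmetric])
      then have "w\<^sup>2 - 1 = w * (w - cnj w)"
        by (simp add: algebra_simps power2_eq_square)
      then have "cmod (w\<^sup>2 - 1) = cmod (w - cnj w)"
        using w by (simp add: norm_mult)
      also have "\<dots> = 2 * \<bar>Im w\<bar>"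
        by (simp add: complex_diff_cnj norm_mult)
      finally have eq: "cmod (w\<^sup>2 - 1) = 2 * \<bar>Im w\<bar>" .
      have "cmod (g w) = cmod (deriv h w) * \<bar>Im w\<bar> ^ (N + 1) * 2 ^ (N + 1)"
        unfolding g_def norm_mult norm_power eq by (simp add: power_mult_distrib)
      \<comment> \<open>The estimate \<open>circle\<close> does not apply at w = 1 and w = -1, but
        there \<open>g\<close> vanishes because the exponent is positive.\<close>
      also have "\<dots> \<le> K1 * V * 2 ^ (N + 1)"
        using circle[OF w] K1 V by (cases "Im w = 0") (auto intro!: mult_right_mono)
      finally show "cmod (g w) \<le> K1 * V * 2 ^ (N + 1)" .
    qed (use z in auto)
    moreover have "3/4 \<le> cmod (z\<^sup>2 - 1)"
    proof -
      have "cmod (z\<^sup>2) \<le> (1/2)\<^sup>2"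
        unfolding norm_power using z by (intro power_mono) auto
      then show ?thesis
        using norm_triangle_ineq2[of 1 "z\<^sup>2"] by (simp add: norm_minus_commute power2_eq_square)
    qed
    then have "cmod (deriv h z) * (3/4) ^ (N + 1) \<le> cmod (g z)"
      unfolding g_def norm_mult norm_power by (intro mult_left_mono power_mono) auto
    ultimately have "cmod (deriv h z) * (3/4) ^ (N + 1) \<le> K1 * V * 2 ^ (N + 1)"
      by linarith
    then have "cmod (deriv h z) * (3/4) ^ (N + 1) * (4/3) ^ (N + 1) \<le> K1 * V * 2 ^ (N + 1) * (4/3) ^ (N + 1)"
      by (intro mult_right_mono) auto
    moreover have "(3/4) ^ (N + 1) * (4/3) ^ (N + 1) = (3/4 * (4/3) :: real) ^ (N + 1)"
      by (simp only: power_mult_distrib)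
    then have "cmod (deriv h z) * (3/4) ^ (N + 1) * (4/3) ^ (N + 1) = cmod (deriv h z)"
      by (simp only: mult.assoc) simp
    ultimately show ?thesis
      unfolding K2_def V_def[symmetric] by (simp only: mult_ac)
  qed
  moreover have "K2 > 0"
    using K1 by (simp add: K2_def)
  ultimately show ?thesis
    by (intro exI[of _ K2] conjI allI impI) auto
qed

section \<open>Normal families argument in a disc centred on the line\<close>

text \<open>If |f_k| were at least e at some x in the small disc, Schottky's theorem for 1/f_k about
  x would bound |1/f_k(q)|, which is impossible once f_k(q) is small enough. The radius does not
  depend on q, as the connectedness argument below requires.\<close>

lemma uniform_limit_0_of_tendsto_0:
  assumes f: "\<And>k. omits01_on (f k) S" and S: "open S" "z \<in> S"
  shows "\<exists>r>0. ball z r \<subseteq> S \<and>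
    (\<forall>q\<in>ball z r. (\<lambda>k. f k q) \<longlonglongrightarrow> 0 \<longrightarrow> uniform_limit (ball z r) f (\<lambda>_. 0) sequentially)"
proof -
  obtain R where R: "R > 0" "ball z R \<subseteq> S"
    using S openE by blast
  show ?thesis
  \<comment> \<open>Two points of \<open>ball z (R / 16)\<close> are less than R/8 apart, which is
    the range of Schottky's theorem in discs of radius R/2; these discs stay inside
    \<open>ball z R\<close>.\<close>
  proof (intro exI[of _ "R / 16"] conjI ballI impI)
    show "R / 16 > 0" "ball z (R / 16) \<subseteq> S"
      using R by auto
    fix q assume q: "q \<in> ball z (R / 16)" "(\<lambda>k. f k q) \<longlonglongrightarrow> 0"
    show "uniform_limit (ball z (R / 16)) f (\<lambda>_. 0) sequentially"
    proof (rule uniform_limitI)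
      fix e :: real assume e: "e > 0"
      have "\<forall>\<^sub>F k in sequentially. dist (f k q) 0 < 1 / schottky_bound (1 / e)"
        using q(2) schottky_bound_pos by (intro tendstoD) auto
      then show "\<forall>\<^sub>F k in sequentially. \<forall>x\<in>ball z (R / 16). dist (f k x) 0 < e"
      proof eventually_elim
        case (elim k)
        show ?case
        proof (rule ballI, rule ccontr)
          fix x assume x: "x \<in> ball z (R / 16)" and "\<not> dist (f k x) 0 < e"
          then have ge: "cmod (f k x) \<ge> e"
            by simp
          have sub: "ball x (R / 2) \<subseteq> S"
          proof
            fix y assume "y \<in> ball x (R / 2)"
            then have "y \<in> ball z R"
              using x R(1) dist_triangle[of z y x] by simp
            then show "y \<in> S"
              using R by blast
          qed
          have "cmod (inverse (f k q)) \<le> schottky_bound (1 / e)"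
          proof (rule schottky_ball[where f = "\<lambda>y. inverse (f k y)"])
            show "omits01_on (\<lambda>y. inverse (f k y)) (ball x (R / 2))"
              using f sub omits01_on_subset omits01_on_inverse by blast
            show "cmod (inverse (f k x)) \<le> 1 / e"
              unfolding norm_inverse using le_imp_inverse_le[OF ge e] by (simp only: inverse_eq_divide)
            show "dist x q \<le> R / 2 / 4"
              using dist_triangle[of x q z] x q(1) by (simp add: dist_commute)
          qed (use R in auto)
          moreover have "f k q \<noteq> 0"
            using f[of k] q(1) R by (auto simp: omits01_on_def subset_iff)
          ultimately show False
            using elim schottky_bound_pos[of "1 / e"] by (simp add: norm_divide field_simps)
        qed
      qed
    qed
  qed
qed

text \<open>On each small disc, convergence to 0 holds at every point or at none, so on a connected
  set it is decided at one point.\<close>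

lemma tendsto_0_propagates:
  assumes f: "\<And>k. omits01_on (f k) S" and S: "open S" "connected S"
    and "p \<in> S" "(\<lambda>k. f k p) \<longlonglongrightarrow> 0" "z \<in> S"
  shows "(\<lambda>k. f k z) \<longlonglongrightarrow> 0"
proof (rule connected_induction_simple[OF S(2) \<open>p \<in> S\<close> \<open>z \<in> S\<close>, where P = "\<lambda>z. (\<lambda>k. f k z) \<longlonglongrightarrow> 0"])
  fix x assume x: "x \<in> S"
  obtain r where r: "r > 0" "ball x r \<subseteq> S" 
      "\<forall>q\<in>ball x r. (\<lambda>k. f k q) \<longlonglongrightarrow> 0 \<longrightarrow> uniform_limit (ball x r) f (\<lambda>_. 0) sequentially"
    using uniform_limit_0_of_tendsto_0[of f, OF f S(1) x] by (elim exE conjE)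
  show "\<exists>T. openin (top_of_set S) T \<and> x \<in> T \<and>
          (\<forall>y\<in>T. \<forall>z\<in>T. (\<lambda>k. f k y) \<longlonglongrightarrow> 0 \<longrightarrow> (\<lambda>k. f k z) \<longlonglongrightarrow> 0)"
  proof (intro exI[of _ "ball x r"] conjI ballI impI)
    show "openin (top_of_set S) (ball x r)"
      using r(2) S(1) by (simp add: openin_open_eq)
    fix y z assume y: "y \<in> ball x r" "(\<lambda>k. f k y) \<longlonglongrightarrow> 0" and z: "z \<in> ball x r"
    show "(\<lambda>k. f k z) \<longlonglongrightarrow> 0"
      by (rule tendsto_uniform_limitI[OF r(3)[rule_format, OF y] z])
  qed (use r in auto)
qed (use assms in auto)

section \<open>Limits of rescaled logarithms\<close>

lemma Re_pos_of_Re_nonneg: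
  assumes G: "G holomorphic_on S" and S: "open S" "connected S"
    and nonneg: "\<And>z. z \<in> S \<Longrightarrow> Re (G z) \<ge> 0"
    and p: "p \<in> S" "Re (G p) \<noteq> 0" and z: "z \<in> S"
  shows "Re (G z) > 0"
proof (rule ccontr)
  assume "\<not> Re (G z) > 0"
  with nonneg[OF z] have Re0: "Re (G z) = 0"
    by simp
  \<comment> \<open>This is the minimum principle for the harmonic function Re G: at a zero of it,
    the open image of \<open>G\<close> would extend into the left half plane.\<close>
  then have "\<not> G constant_on S"
    using p z unfolding constant_on_def by metis
  then have "open (G ` S)"
    using open_mapping_thm[OF G S] S by blast
  then obtain e where e: "e > 0" "ball (G z) e \<subseteq> G ` S"
    using z openE by blast
  have "G z - of_real (e / 2) \<in> ball (G z) e"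
    using e by (simp add: dist_norm)
  then have "G z - of_real (e / 2) \<in> G ` S"
    using e by blast
  then obtain w where w: "w \<in> S" "G w = G z - of_real (e / 2)"
    by auto
  have "Re (G w) = - e / 2"
    unfolding w(2) using Re0 by simp
  then show False
    using nonneg[OF w(1)] e by simp
qed

lemma uniform_limit_exp_0:
  fixes H :: "nat \<Rightarrow> complex \<Rightarrow> complex"
  assumes K: "compact K" and H: "uniform_limit K H G sequentially"
    and G: "continuous_on K G" "\<And>z. z \<in> K \<Longrightarrow> Re (G z) > 0"
    and M: "filterlim M at_top sequentially"
  shows "uniform_limit K (\<lambda>k z. exp (- (of_real (M k) * H k z))) (\<lambda>_. 0) sequentially"
proof (cases "K = {}")
  case True
  then show ?thesis
    by (simp add: uniform_limit_iff)
next
  case False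
  have "continuous_on K (\<lambda>z. Re (G z))"
    by (intro continuous_intros G)
  then obtain w where w: "w \<in> K" "\<And>z. z \<in> K \<Longrightarrow> Re (G w) \<le> Re (G z)"
    using continuous_attains_inf[OF K False] by blast
  \<comment> \<open>\<open>d\<close> is half the minimum of Re G on \<open>K\<close>, so that Re H_k
    \<ge> d for large k and the exponentials have modulus at most exp (- d * M_k).\<close>
  define d where "d = Re (G w) / 2"
  have d: "d > 0"
    using G(2) w(1) by (simp add: d_def)
  show ?thesis
  proof (rule uniform_limitI)
    fix e :: real assume e: "e > 0"
    have "\<forall>\<^sub>F k in sequentially. \<forall>z\<in>K. dist (H k z) (G z) < d"
      using H d by (rule uniform_limitD)
    moreover have "\<forall>\<^sub>F k in sequentially. M k > max 0 (- ln e / d)"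
      using M unfolding filterlim_at_top_dense by (rule spec)
    ultimately show "\<forall>\<^sub>F k in sequentially. \<forall>z\<in>K. dist (exp (- (of_real (M k) * H k z))) 0 < e"
    proof eventually_elim
      case (elim k)
      show ?case
      proof
        fix z assume z: "z \<in> K"
        have "\<bar>Re (H k z - G z)\<bar> < d"
          using elim(1) z abs_Re_le_cmod[of "H k z - G z"] by (fastforce simp: dist_norm)
        then have "Re (H k z) \<ge> d"
          using w(2)[OF z] unfolding minus_complex.sel d_def by linarith
        then have "M k * Re (H k z) \<ge> M k * d"
          using elim(2) by (intro mult_left_mono) auto
        moreover have "M k * d > - ln e"
          using elim(2) d by (simp add: field_simps)
        ultimately have "- (M k * Re (H k z)) < ln e"
          by simp
        then have "exp (- (M k * Re (H k z))) < exp (ln e)"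
          by (subst exp_less_cancel_iff)
        then show "dist (exp (- (of_real (M k) * H k z))) 0 < e"
          using e by simp
      qed
    qed
  qed
qed

lemma exists_off_real_line:
  assumes "open U" "z \<in> U"
  shows "\<exists>w\<in>U. Im w \<noteq> 0"
proof (cases "Im z = 0")
  case True
  obtain e where e: "e > 0" "ball z e \<subseteq> U"
    using assms openE by blast
  have "z + \<i> * of_real (e / 2) \<in> ball z e"
    using e by (simp add: dist_norm norm_mult)
  then show ?thesis
    using e True by (intro bexI[of _ "z + \<i> * of_real (e / 2)"]) auto
qed (use assms in auto)

text \<open>The logarithms divided by \<open>M k\<close> form a bounded family, and the sign of the
  real part of a limit \<open>G\<close> tells where f_k tends to 0 and where to \<infinity>. The
  hypotheses \<open>no_lim\<close> and \<open>no_inf\<close> force both signs to occur.\<close>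

lemma normalized_dichotomy:
  fixes f :: "nat \<Rightarrow> complex \<Rightarrow> complex"
  assumes hol: "\<And>k. f k holomorphic_on ball 0 4"
    and nz: "\<And>k z. z \<in> ball 0 4 \<Longrightarrow> f k z \<noteq> 0"
    and one: "\<And>k z. z \<in> ball 0 4 \<Longrightarrow> f k z = 1 \<Longrightarrow> Im z = 0"
    and no_lim: "\<And>r g. strict_mono r \<Longrightarrow> \<not> uniform_limit (cball 0 (1/4)) (f \<circ> r) g sequentially"
    and no_inf: "\<And>r :: nat \<Rightarrow> nat. strict_mono r \<Longrightarrow>
      \<not> uniform_limit (cball 0 (1/4)) (\<lambda>k z. inverse (f (r k) z)) (\<lambda>_. 0) sequentially"
  obtains r :: "nat \<Rightarrow> nat" and z w where "strict_mono r" "z \<in> ball 0 4" "Im z \<noteq> 0" "w \<in> ball 0 4" "Im w \<noteq> 0"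
    "(\<lambda>k. f (r k) z) \<longlonglongrightarrow> 0" "(\<lambda>k. inverse (f (r k) w)) \<longlonglongrightarrow> 0"
proof -
  obtain K where K: "K > 0"
    "\<forall>f h z. h holomorphic_on ball 0 4 \<longrightarrow> (\<forall>z\<in>ball 0 4. f z = exp (h z)) \<longrightarrow>
      (\<forall>z\<in>ball 0 4. f z = 1 \<longrightarrow> Im z = 0) \<longrightarrow> cmod z \<le> 1/2 \<longrightarrow>
      cmod (deriv h z) \<le> K * (logsize f (\<i> / 4) + logsize f (- \<i> / 4))"
    using deriv_log_bound by (elim exE conjE)
  have "\<exists>h. h holomorphic_on ball 0 4 \<and> (\<forall>z\<in>ball 0 4. exp (h z) = f k z)" for k
    using holomorphic_logarithm_exists[of "ball 0 4" "f k" 0] hol nz by (metis centre_in_ball convex_ball open_ball zero_less_numeral)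
  then obtain h where h: "\<And>k. h k holomorphic_on ball 0 4" "\<And>k z. z \<in> ball 0 4 \<Longrightarrow> f k z = exp (h k z)"
    by metis
  have ln_f: "ln (cmod (f k z)) = Re (h k z)" if "z \<in> ball 0 4" for k z
    using h(2)[OF that] by simp
  define M where "M = (\<lambda>k. logsize (f k) (\<i> / 4) + logsize (f k) (- \<i> / 4))"
  have M_eq: "M k = 2 + \<bar>Re (h k (\<i> / 4))\<bar> + \<bar>Re (h k (- \<i> / 4))\<bar>" for k
    by (simp add: M_def logsize_def ln_f)
  have M_ge: "M k \<ge> 2" for k
    by (simp add: M_eq)
  define B where "B = ball (0::complex) (1/2)"
  have B_sub: "B \<subseteq> ball 0 4"
    by (auto simp: B_def)
  have B_pts: "\<i> / 4 \<in> B" "- \<i> / 4 \<in> B"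
    by (auto simp: B_def)
  \<comment> \<open>Logarithms are determined only up to multiples of 2 pi i, so their imaginary
    parts need not be bounded in terms of \<open>M k\<close>. Subtracting the one at i/4 repairs
    this and changes exp only by a factor of modulus 1.\<close>
  define H where "H = (\<lambda>k z. (h k z - \<i> * of_real (Im (h k (\<i> / 4)))) / of_real (M k))"
  have Re_H: "Re (H k z) = Re (h k z) / M k" for k z
    by (simp add: H_def)
  have H_hol: "H k holomorphic_on B" for k
    unfolding H_def using M_ge[of k] by (intro holomorphic_intros holomorphic_on_subset[OF h(1) B_sub]) auto
  \<comment> \<open>Over distances at most 1 in the convex set \<open>B\<close>, the derivative
    bound controls the variation of \<open>h k\<close> by \<open>K * M k\<close>. The value left at
    i/4 is real and at most \<open>M k\<close> in modulus.\<close>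
  have H_bound: "cmod (H k z) \<le> K + 1" if z: "z \<in> B" for k z
  proof -
    have "cmod (h k z - h k (\<i> / 4)) \<le> K * M k * cmod (z - \<i> / 4)"
    proof (rule field_differentiable_bound[of B])
      fix w assume w: "w \<in> B"
      show "(h k has_field_derivative deriv (h k) w) (at w within B)"
        using w B_sub h(1)[of k] by (intro has_field_derivative_at_within[OF holomorphic_derivI[where S = "ball 0 4"]]) auto
      show "cmod (deriv (h k) w) \<le> K * M k"
        unfolding M_def using w h one by (intro K(2)[rule_format]) (auto simp: B_def)
    qed (use z B_pts in \<open>auto simp: B_def\<close>)
    also have "\<dots> \<le> K * M k * 1"
      using z norm_triangle_ineq4[of z "\<i> / 4"] K(1) M_ge[of k]
      by (intro mult_left_mono) (auto simp: B_def)
    finally have 1: "cmod (h k z - h k (\<i> / 4)) \<le> K * M k"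
      by simp
    have a: "h k (\<i> / 4) - \<i> * of_real (Im (h k (\<i> / 4))) = of_real (Re (h k (\<i> / 4)))"
      by (metis add_diff_cancel_right' complex_eq)
    have b: "H k z * of_real (M k) = h k z - \<i> * of_real (Im (h k (\<i> / 4)))"
      using M_ge[of k] by (simp add: H_def)
    have "H k z * of_real (M k) = (h k z - h k (\<i> / 4)) + of_real (Re (h k (\<i> / 4)))"
    proof -
      have "x = z - a + c" if "a - b = c" "x = z - b" for a b c x z :: complex
        unfolding that(2) that(1)[symmetric] by simp
      from this[OF a b] show ?thesis .
    qed
    then have "cmod (H k z * of_real (M k)) \<le> cmod (h k z - h k (\<i> / 4)) + cmod (of_real (Re (h k (\<i> / 4))))"
      by (simp only: norm_triangle_ineq)
    moreover have "cmod (H k z * of_real (M k)) = cmod (H k z) * M k"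
      using M_ge[of k] by (simp add: norm_mult)
    ultimately have "cmod (H k z) * M k \<le> K * M k + \<bar>Re (h k (\<i> / 4))\<bar>"
      using 1 by (simp only: norm_of_real)
    also have "\<dots> \<le> (K + 1) * M k"
      by (simp add: M_eq algebra_simps)
    finally show ?thesis
      using M_ge[of k] mult_right_le_imp_le[of "cmod (H k z)" "M k" "K + 1"] by simp
  qed
  have f_H: "f k z = exp (of_real (M k) * H k z) * exp (\<i> * of_real (Im (h k (\<i> / 4))))" if "z \<in> B" for k z
  proof -
    have "f k z = exp (h k z)"
      using that B_sub h(2) by blast
    also have "h k z = of_real (M k) * H k z + \<i> * of_real (Im (h k (\<i> / 4)))"
      using M_ge[of k] by (simp add: H_def)
    finally show ?thesis
      by (simp add: exp_add)
  qed
  have cmod_f: "cmod (f k z) = cmod (exp (- (of_real (M k) * - H k z)))"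
      and cmod_inv_f: "cmod (inverse (f k z)) = cmod (exp (- (of_real (M k) * H k z)))" if "z \<in> B" for k z
    unfolding f_H[OF that] by (simp_all add: norm_mult norm_inverse exp_minus)
  have cball_B: "cball 0 (1/4) \<subseteq> B"
    by (auto simp: B_def)
  \<comment> \<open>Otherwise \<open>M\<close> is bounded along a subsequence. The f_k are then
    uniformly bounded on \<open>B\<close> along it, and Montel's theorem contradicts
    \<open>no_lim\<close>.\<close>
  have M_lim: "filterlim M at_top sequentially"
  proof (rule ccontr)
    assume "\<not> filterlim M at_top sequentially"
    then obtain C where "\<not> eventually (\<lambda>k. C \<le> M k) sequentially"
      by (auto simp: filterlim_at_top)
    then obtain r :: "nat \<Rightarrow> nat" where r: "strict_mono r" "\<And>k. \<not> C \<le> M (r k)"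
      using not_eventually_sequentiallyD by blast
    have bd: "cmod (f (r k) z) \<le> exp (C * (K + 1))" if z: "z \<in> B" for k z
    proof -
      have "M (r k) * Re (H (r k) z) \<le> M (r k) * (K + 1)"
        using M_ge[of "r k"] H_bound[OF z, of "r k"] complex_Re_le_cmod[of "H (r k) z"]
        by (intro mult_left_mono) auto
      also have "\<dots> \<le> C * (K + 1)"
        using r(2)[of k] K(1) by (intro mult_right_mono) auto
      finally show ?thesis
        unfolding cmod_f[OF z] by simp
    qed
    obtain g s where s: "strict_mono (s :: nat \<Rightarrow> nat)"
      and gs: "\<And>X. compact X \<Longrightarrow> X \<subseteq> B \<Longrightarrow> uniform_limit X ((\<lambda>k. f (r k)) \<circ> s) g sequentially"
    proof (rule Montel[of B "range (\<lambda>k. f (r k))" "\<lambda>k. f (r k)"])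
      show "open B"
        by (simp add: B_def)
      show "h holomorphic_on B" if "h \<in> range (\<lambda>k. f (r k))" for h
        using that hol holomorphic_on_subset[OF _ B_sub] by auto
      show "\<exists>A. \<forall>h\<in>range (\<lambda>k. f (r k)). \<forall>z\<in>X. cmod (h z) \<le> A" if "X \<subseteq> B" for X
        using that bd by (intro exI[of _ "exp (C * (K + 1))"]) auto
    qed auto
    have "uniform_limit (cball 0 (1/4)) (f \<circ> (r \<circ> s)) g sequentially"
      using gs[of "cball 0 (1/4)"] cball_B by (simp add: o_def)
    then show False
      using no_lim[OF strict_mono_o[OF r(1) s]] by simp
  qed
  obtain G r where G: "G holomorphic_on B" and r: "strict_mono (r :: nat \<Rightarrow> nat)"
      and lim: "\<And>z. z \<in> B \<Longrightarrow> (\<lambda>k. H (r k) z) \<longlonglongrightarrow> G z"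
      and unif: "\<And>X. compact X \<Longrightarrow> X \<subseteq> B \<Longrightarrow> uniform_limit X (H \<circ> r) G sequentially"
  proof (rule Montel[of B "range H" H])
    show "open B"
      by (simp add: B_def)
    show "h holomorphic_on B" if "h \<in> range H" for h
      using that H_hol by auto
    show "\<exists>C. \<forall>h\<in>range H. \<forall>z\<in>X. cmod (h z) \<le> C" if "compact X" "X \<subseteq> B" for X
      using that H_bound by blast
  qed auto
  have Mr_lim: "filterlim (\<lambda>k. M (r k)) at_top sequentially"
    using filterlim_compose[OF M_lim filterlim_subseq[OF r]] .
  \<comment> \<open>The normalisation makes the corresponding sum for \<open>H k\<close> equal to
    \<open>1 - 2 / M k\<close>. Hence Re G does not vanish at both base points, and the minimum
    principle can be applied.\<close>
  have G_nz: "\<bar>Re (G (\<i> / 4))\<bar> + \<bar>Re (G (- \<i> / 4))\<bar> = 1"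
  proof (rule LIMSEQ_unique)
    show "(\<lambda>k. \<bar>Re (H (r k) (\<i> / 4))\<bar> + \<bar>Re (H (r k) (- \<i> / 4))\<bar>) \<longlonglongrightarrow> \<bar>Re (G (\<i> / 4))\<bar> + \<bar>Re (G (- \<i> / 4))\<bar>"
      by (intro tendsto_intros lim B_pts)
    have "(\<lambda>k. 1 - 2 / M (r k)) \<longlonglongrightarrow> 1 - 0"
      by (intro tendsto_intros tendsto_divide_0[OF tendsto_const] filterlim_at_top_imp_at_infinity Mr_lim)
    moreover have "\<bar>Re (H k (\<i> / 4))\<bar> + \<bar>Re (H k (- \<i> / 4))\<bar> = 1 - 2 / M k" for k
    proof -
      have "\<bar>Re (H k (\<i> / 4))\<bar> + \<bar>Re (H k (- \<i> / 4))\<bar> = (\<bar>Re (h k (\<i> / 4))\<bar> + \<bar>Re (h k (- \<i> / 4))\<bar>) / M k"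
        using M_ge[of k] by (simp add: Re_H abs_divide add_divide_distrib)
      also have "\<dots> = (M k - 2) / M k"
        by (simp add: M_eq)
      finally show ?thesis
        using M_ge[of k] by (simp add: diff_divide_distrib)
    qed
    ultimately show "(\<lambda>k. \<bar>Re (H (r k) (\<i> / 4))\<bar> + \<bar>Re (H (r k) (- \<i> / 4))\<bar>) \<longlonglongrightarrow> 1"
      by simp
  qed
  have G_cont: "continuous_on X G" if "X \<subseteq> B" for X
    using G that holomorphic_on_imp_continuous_on continuous_on_subset by blast
  have to_inf: "uniform_limit X (\<lambda>k z. inverse (f (r k) z)) (\<lambda>_. 0) sequentially"
    if X: "compact X" "X \<subseteq> B" "\<And>z. z \<in> X \<Longrightarrow> Re (G z) > 0" for X
  proof -
    have "uniform_limit X (\<lambda>k z. exp (- (of_real (M (r k)) * (H \<circ> r) k z))) (\<lambda>_. 0) sequentially"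
      by (rule uniform_limit_exp_0[OF X(1) unif[OF X(1,2)] G_cont[OF X(2)] X(3) Mr_lim])
    then show ?thesis
      unfolding uniform_limit_iff dist_0_norm dist_norm using cmod_inv_f X(2)
      by (simp add: subset_iff)
  qed
  have to_0: "uniform_limit X (f \<circ> r) (\<lambda>_. 0) sequentially"
    if X: "compact X" "X \<subseteq> B" "\<And>z. z \<in> X \<Longrightarrow> Re (G z) < 0" for X
  proof -
    have "uniform_limit X (\<lambda>k z. - (H \<circ> r) k z) (\<lambda>z. - G z) sequentially"
      by (rule uniform_limit_uminus[OF unif[OF X(1,2)]])
    then have "uniform_limit X (\<lambda>k z. exp (- (of_real (M (r k)) * - (H \<circ> r) k z))) (\<lambda>_. 0) sequentially"
      by (rule uniform_limit_exp_0[OF X(1) _ continuous_on_minus[OF G_cont[OF X(2)]] _ Mr_lim]) (simp add: X(3))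
    then show ?thesis
      unfolding uniform_limit_iff dist_norm using cmod_f X(2)
      by (simp add: subset_iff)
  qed
  have B_oc: "open B" "connected B"
    by (auto simp: B_def)
  have "Re (G (\<i> / 4)) \<noteq> 0 \<or> Re (G (- \<i> / 4)) \<noteq> 0"
    using G_nz by linarith
  then obtain p where p: "p \<in> B" "Re (G p) \<noteq> 0"
    using B_pts by blast
  \<comment> \<open>If Re G were nonnegative on \<open>B\<close>, it would be positive there, and
    f_k would tend to \<infinity> uniformly on \<open>cball 0 (1/4)\<close>, against
    \<open>no_inf\<close>.\<close>
  have ex_neg: "\<exists>z\<in>B. Re (G z) < 0"
  proof (rule ccontr)
    assume "\<not> ?thesis"
    then have nonneg: "Re (G z) \<ge> 0" if "z \<in> B" for z
      using that by (simp add: not_less)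
    show False
      using no_inf[OF r] to_inf[OF compact_cball cball_B
          Re_pos_of_Re_nonneg[OF G B_oc nonneg p subsetD[OF cball_B]]] by (rule notE)
  qed
  \<comment> \<open>Being open, the two sign regions contain points off the real line. Such points
    are needed because the limits spread only where f_k omits 1.\<close>
  have op: "open {z \<in> B. Re (G z) < 0}" "open {z \<in> B. 0 < Re (G z)}"
    using continuous_open_preimage[OF G_cont[OF order_refl] B_oc(1), of "{w. Re w < 0}"]
      continuous_open_preimage[OF G_cont[OF order_refl] B_oc(1), of "{w. Re w > 0}"]
    by (simp_all add: open_halfspace_Re_lt open_halfspace_Re_gt vimage_def Int_def)
  have ex_pos: "\<exists>z\<in>B. Re (G z) > 0"
  proof (rule ccontr)
    assume "\<not> ?thesis"
    then have "Re (- G z) \<ge> 0" if "z \<in> B" for z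
      using that by (simp add: not_less)
    then have "Re (- G z) > 0" if "z \<in> B" for z
      using Re_pos_of_Re_nonneg[of "\<lambda>z. - G z", OF holomorphic_on_minus[OF G] B_oc _ p(1) _ that] p(2) by simp
    then have neg: "Re (G z) < 0" if "z \<in> B" for z
      using that by simp
    show False
      using no_lim[OF r] to_0[OF compact_cball cball_B neg[OF subsetD[OF cball_B]]] by (rule notE)
  qed
  obtain z where z: "z \<in> B" "Re (G z) < 0" "Im z \<noteq> 0"
    using ex_neg exists_off_real_line[OF op(1)] by auto
  obtain w where w: "w \<in> B" "Re (G w) > 0" "Im w \<noteq> 0"
    using ex_pos exists_off_real_line[OF op(2)] by auto
  have "uniform_limit {z} (f \<circ> r) (\<lambda>_. 0) sequentially"
    by (rule to_0) (use z in auto)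
  from tendsto_uniform_limitI[OF this, of z] have z_lim: "(\<lambda>k. f (r k) z) \<longlonglongrightarrow> 0"
    by (simp add: o_def)
  have "uniform_limit {w} (\<lambda>k z. inverse (f (r k) z)) (\<lambda>_. 0) sequentially"
    by (rule to_inf) (use w in auto)
  from tendsto_uniform_limitI[OF this, of w] have w_lim: "(\<lambda>k. inverse (f (r k) w)) \<longlonglongrightarrow> 0"
    by simp
  show ?thesis
    using z(1) w(1) B_sub by (intro that[OF r _ z(3) _ w(3) z_lim w_lim]) auto
qed

section \<open>Spherical convergence\<close>

text \<open>Unit vectors at chordal distance d have inner product 1 - d^2 / 2, and here d = 2 |z -
  w| / sqrt ((1 + |z|^2) (1 + |w|^2)).\<close>

lemma stereo_inner_Some:
  "stereo (Some z) \<bullet> stereo (Some w) = 1 - 2 * (cmod (z - w))\<^sup>2 / ((1 + (cmod z)\<^sup>2) * (1 + (cmod w)\<^sup>2))"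
proof -
  define a b c where "a = (cmod z)\<^sup>2" and "b = (cmod w)\<^sup>2" and "c = z \<bullet> w"
  have ab: "1 + a > 0" "1 + b > 0"
    by (auto simp: a_def b_def add_pos_nonneg)
  have d: "(cmod (z - w))\<^sup>2 = a + b - 2 * c"
    unfolding a_def b_def c_def power2_norm_eq_inner by (simp add: inner_diff inner_commute)
  have "stereo (Some z) \<bullet> stereo (Some w) = 2 / (1 + a) * (2 / (1 + b)) * c + (a - 1) / (a + 1) * ((b - 1) / (b + 1))"
    by (simp add: a_def b_def c_def)
  also have "\<dots> = (4 * c + (a - 1) * (b - 1)) / ((1 + a) * (1 + b))"
    by (simp add: add_divide_distrib add.commute)
  also have "4 * c + (a - 1) * (b - 1) = (1 + a) * (1 + b) - 2 * (a + b - 2 * c)"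
    by (simp add: algebra_simps)
  finally show ?thesis
    using ab unfolding d a_def[symmetric] b_def[symmetric] by (simp add: diff_divide_distrib)
qed

lemma stereo_inner_None:
  "stereo (Some z) \<bullet> stereo None = 1 - 2 / (1 + (cmod z)\<^sup>2)"
proof -
  have "1 + (cmod z)\<^sup>2 \<noteq> 0"
    by (smt (verit) zero_le_power2)
  then show ?thesis
    by (simp add: divide_simps) 
qed

lemma norm_stereo: "norm (stereo p) = 1"
proof (cases p)
  case (Some z)
  then show ?thesis
    using stereo_inner_Some[of z z] by (simp add: norm_eq_1)
qed simp

lemma spherical_dist_eventually_less:
  assumes lim: "uniform_limit S (\<lambda>k z. stereo (p k z) \<bullet> stereo (q z)) (\<lambda>_. 1) sequentially" and e: "e > 0"
  shows "\<forall>\<^sub>F k in sequentially. \<forall>z\<in>S. spherical_dist (p k z) (q z) < e"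
proof -
  \<comment> \<open>The truncation at \<open>pi\<close> ensures that
    \<open>arccos (cos e') = e'\<close>.\<close>
  define e' where "e' = min e pi"
  have e': "0 < e'" "e' \<le> pi" "e' \<le> e"
    using e by (auto simp: e'_def)
  have "cos e' < 1"
    using cos_monotone_0_pi[of 0 e'] e' by simp
  then have "\<forall>\<^sub>F k in sequentially. \<forall>z\<in>S. dist (stereo (p k z) \<bullet> stereo (q z)) 1 < 1 - cos e'"
    by (intro uniform_limitD[OF lim]) auto
  then show ?thesis
  proof eventually_elim
    case (elim k)
    show ?case
    proof
      fix z assume "z \<in> S"
      from bspec[OF elim this] have "cos e' < stereo (p k z) \<bullet> stereo (q z)"
        unfolding dist_real_def by linarith
      moreover have "stereo (p k z) \<bullet> stereo (q z) \<le> 1"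
        using norm_cauchy_schwarz[of "stereo (p k z)" "stereo (q z)"] by (simp add: norm_stereo)
      ultimately have "arccos (stereo (p k z) \<bullet> stereo (q z)) < arccos (cos e')"
        by (intro arccos_less_arccos) auto
      also have "\<dots> = e'"
        using e' by (simp add: arccos_cos)
      finally show "spherical_dist (p k z) (q z) < e"
        using e' by (simp add: spherical_dist_def)
    qed
  qed
qed

lemma spherical_dist_Some_eventually_less:
  assumes lim: "uniform_limit S f g sequentially" and "e > 0"
  shows "\<forall>\<^sub>F k in sequentially. \<forall>z\<in>S. spherical_dist (Some (f k z)) (Some (g z)) < e"
proof (rule spherical_dist_eventually_less[OF _ \<open>e > 0\<close>], rule uniform_limitI)
  fix d :: real assume d: "d > 0"
  \<comment> \<open>Since the denominator in \<open>stereo_inner_Some\<close> is at least 1, the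
    inner product differs from 1 by at most 2 |f_k - g|^2. No bound on \<open>g\<close> is
    required.\<close>
  have "\<forall>\<^sub>F k in sequentially. \<forall>z\<in>S. dist (f k z) (g z) < sqrt (d / 2)"
    using d by (intro uniform_limitD[OF lim]) auto
  then show "\<forall>\<^sub>F k in sequentially. \<forall>z\<in>S. dist (stereo (Some (f k z)) \<bullet> stereo (Some (g z))) 1 < d"
  proof eventually_elim
    case (elim k)
    show ?case
    proof
      fix z assume z: "z \<in> S"
      define D where "D = (1 + (cmod (f k z))\<^sup>2) * (1 + (cmod (g z))\<^sup>2)"
      have D: "D \<ge> 1"
        unfolding D_def using mult_mono[of 1 "1 + (cmod (f k z))\<^sup>2" 1 "1 + (cmod (g z))\<^sup>2"] by simp
      have "(cmod (f k z - g z))\<^sup>2 < (sqrt (d / 2))\<^sup>2"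
        using elim z by (intro power_strict_mono) (auto simp: dist_norm)
      then have "2 * (cmod (f k z - g z))\<^sup>2 < d"
        using d by simp
      moreover have "2 * (cmod (f k z - g z))\<^sup>2 / D \<le> 2 * (cmod (f k z - g z))\<^sup>2"
        using D divide_left_mono[of 1 D "2 * (cmod (f k z - g z))\<^sup>2"] by simp
      moreover have "2 * (cmod (f k z - g z))\<^sup>2 / D \<ge> 0"
        using D by simp
      ultimately show "dist (stereo (Some (f k z)) \<bullet> stereo (Some (g z))) 1 < d"
        unfolding stereo_inner_Some D_def[symmetric] by (simp add: dist_real_def)
    qed
  qed
qed

text \<open>The inner product with the north pole differs from 1 by 2 / (1 + |f|^2) \<le> 2 |1/f|^2.
  Zeros are excluded because \<open>inverse 0 = 0\<close> would make them look like values near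
  \<infinity>.\<close>

lemma spherical_dist_None_eventually_less:
  assumes lim: "uniform_limit S (\<lambda>k z. inverse (f k z)) (\<lambda>_. 0) sequentially"
    and nz: "\<And>k z. z \<in> S \<Longrightarrow> f k z \<noteq> 0" and "e > 0"
  shows "\<forall>\<^sub>F k in sequentially. \<forall>z\<in>S. spherical_dist (Some (f k z)) None < e"
proof (rule spherical_dist_eventually_less[OF _ \<open>e > 0\<close>, where q = "\<lambda>_. None"], rule uniform_limitI)
  fix d :: real assume d: "d > 0"
  have "\<forall>\<^sub>F k in sequentially. \<forall>z\<in>S. dist (inverse (f k z)) 0 < sqrt (d / 2)"
    using d by (intro uniform_limitD[OF lim]) auto
  then show "\<forall>\<^sub>F k in sequentially. \<forall>z\<in>S. dist (stereo (Some (f k z)) \<bullet> stereo None) 1 < d"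
  proof eventually_elim
    case (elim k)
    show ?case
    proof
      fix z assume z: "z \<in> S"
      define t where "t = (cmod (f k z))\<^sup>2"
      have t: "t > 0"
        using nz[OF z] by (simp add: t_def)
      have "(cmod (inverse (f k z)))\<^sup>2 < (sqrt (d / 2))\<^sup>2"
        using elim z by (intro power_strict_mono) auto
      then have "inverse t < d / 2"
        using d by (simp only: norm_inverse power_inverse t_def[symmetric]) simp
      then have "2 / t < d"
        using t by (simp add: field_simps)
      moreover have "2 / (1 + t) \<le> 2 / t"
        using t by (intro divide_left_mono mult_pos_pos) simp_all
      moreover have "2 / (1 + t) \<ge> 0"
        using t by simp
      ultimately show "dist (stereo (Some (f k z)) \<bullet> stereo None) 1 < d"
        unfolding stereo_inner_None t_def[symmetric] by (simp add: dist_real_def)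
    qed
  qed
qed

text \<open>The cosine of the spherical distance is the inner product, and |x - y|^2 = 2 - 2 (x
  \<bullet> y) for unit vectors. Coordinates on the sphere can therefore be used to identify
  limits.\<close>

lemma spherical_dist_tendsto_0_imp:
  assumes "\<And>e. e > 0 \<Longrightarrow> \<forall>\<^sub>F k in sequentially. spherical_dist (x k) q < e"
  shows "(\<lambda>k. stereo (x k)) \<longlonglongrightarrow> stereo q"
proof -
  have bd: "\<bar>stereo (x k) \<bullet> stereo q\<bar> \<le> 1" for k
    using Cauchy_Schwarz_ineq2[of "stereo (x k)" "stereo q"] by (simp add: norm_stereo)
  have "(\<lambda>k. spherical_dist (x k) q) \<longlonglongrightarrow> 0"
  proof (rule tendstoI)
    fix e :: real assume "e > 0"
    moreover have "spherical_dist (x k) q \<ge> 0" for k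
      unfolding spherical_dist_def using bd[of k] by (intro arccos_lbound) auto
    ultimately show "\<forall>\<^sub>F k in sequentially. dist (spherical_dist (x k) q) 0 < e"
      using assms by simp
  qed
  then have "(\<lambda>k. cos (spherical_dist (x k) q)) \<longlonglongrightarrow> cos 0"
    by (rule tendsto_cos)
  moreover have "cos (spherical_dist (x k) q) = stereo (x k) \<bullet> stereo q" for k
    unfolding spherical_dist_def using bd[of k] by (intro cos_arccos_abs)
  ultimately have "(\<lambda>k. stereo (x k) \<bullet> stereo q) \<longlonglongrightarrow> 1"
    by simp
  then have "(\<lambda>k. sqrt (2 - 2 * (stereo (x k) \<bullet> stereo q))) \<longlonglongrightarrow> sqrt (2 - 2 * 1)"
    by (intro tendsto_intros)
  moreover have "dist (stereo (x k)) (stereo q) = sqrt (2 - 2 * (stereo (x k) \<bullet> stereo q))" for k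
    using norm_stereo[of "x k"] norm_stereo[of q]
    by (simp add: dist_norm norm_eq_sqrt_inner inner_diff inner_commute)
  ultimately show ?thesis
    by (subst tendsto_dist_iff) simp
qed

section \<open>Recognising the limits 0 and \<infinity> by the height on the sphere\<close>

lemma snd_stereo_Some: "snd (stereo (Some z)) = 1 - 2 / (1 + (cmod z)\<^sup>2)"
  using stereo_inner_None[of z] by (simp add: inner_prod_def)

lemma snd_stereo_tendsto_iff_0:
  "(\<lambda>k. snd (stereo (Some (x k)))) \<longlonglongrightarrow> -1 \<longleftrightarrow> x \<longlonglongrightarrow> 0"
proof
  assume "x \<longlonglongrightarrow> 0"
  then have "(\<lambda>k. 1 - 2 / (1 + (cmod (x k))\<^sup>2)) \<longlonglongrightarrow> 1 - 2 / (1 + (cmod 0)\<^sup>2)"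
    by (intro tendsto_intros) auto
  then show "(\<lambda>k. snd (stereo (Some (x k)))) \<longlonglongrightarrow> -1"
    unfolding snd_stereo_Some by simp
next
  assume lim: "(\<lambda>k. snd (stereo (Some (x k)))) \<longlonglongrightarrow> -1"
  \<comment> \<open>The relation s = 1 - 2 / (1 + |z|^2) is solved for |z|, which exhibits |z| as a
    continuous function of the height s near -1.\<close>
  have "(\<lambda>k. sqrt (2 / (1 - snd (stereo (Some (x k)))) - 1)) \<longlonglongrightarrow> sqrt (2 / (1 - (-1)) - 1)"
    by (intro tendsto_intros lim) auto
  moreover have "sqrt (2 / (1 - snd (stereo (Some z))) - 1) = cmod z" for z
    unfolding snd_stereo_Some by (simp add: add_divide_distrib)
  ultimately show "x \<longlonglongrightarrow> 0"
    by (simp add: tendsto_norm_zero_iff del: stereo.simps)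
qed

lemma snd_stereo_inverse:
  assumes "z \<noteq> 0"
  shows "snd (stereo (Some (inverse z))) = - snd (stereo (Some z))"
proof -
  define t where "t = (cmod z)\<^sup>2"
  have "t > 0"
    using assms by (simp add: t_def)
  then have "1 - 2 / (1 + inverse t) = - (1 - 2 / (1 + t))"
    by (simp add: field_simps)
  then show ?thesis
    unfolding snd_stereo_Some norm_inverse power_inverse t_def .
qed

text \<open>The whole sequence has a limit on the sphere at \<open>p\<close>, so its height there is
  fixed by any subsequence. Height -1 means the limit 0; the case of \<infinity> reduces to it
  because inversion reverses the sign of the height.\<close>

lemma sph_converges_imp_tendsto_0:
  assumes f: "sph_converges_to f S g" and p: "p \<in> S"
    and r: "strict_mono (r :: nat \<Rightarrow> nat)"
  shows "(\<lambda>k. f (r k) p) \<longlonglongrightarrow> 0 \<Longrightarrow> (\<lambda>k. f k p) \<longlonglongrightarrow> 0"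
    and "(\<And>k. f k p \<noteq> 0) \<Longrightarrow> (\<lambda>k. inverse (f (r k) p)) \<longlonglongrightarrow> 0 \<Longrightarrow> (\<lambda>k. inverse (f k p)) \<longlonglongrightarrow> 0"
proof -
  obtain e where e: "e > 0" "\<forall>d>0. \<forall>\<^sub>F k in sequentially. \<forall>w\<in>ball p e. spherical_dist (Some (f k w)) (g w) < d"
    using bspec[OF f[unfolded sph_converges_to_def] p] by (elim exE conjE)
  have "\<forall>\<^sub>F k in sequentially. spherical_dist (Some (f k p)) (g p) < d" if "d > 0" for d
    using e(2)[rule_format, OF that] by (rule eventually_mono) (use e(1) in auto)
  then have "(\<lambda>k. stereo (Some (f k p))) \<longlonglongrightarrow> stereo (g p)"
    by (rule spherical_dist_tendsto_0_imp)
  then have lim: "(\<lambda>k. snd (stereo (Some (f k p)))) \<longlonglongrightarrow> snd (stereo (g p))"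
    by (rule tendsto_snd)
  have lim_r: "(\<lambda>k. snd (stereo (Some (f (r k) p)))) \<longlonglongrightarrow> snd (stereo (g p))"
    using LIMSEQ_subseq_LIMSEQ[OF lim r] by (simp only: o_def)
  {
    assume "(\<lambda>k. f (r k) p) \<longlonglongrightarrow> 0"
    then have "snd (stereo (g p)) = -1"
      using LIMSEQ_unique[OF lim_r, of "-1"] snd_stereo_tendsto_iff_0[of "\<lambda>k. f (r k) p"] by blast
    then show "(\<lambda>k. f k p) \<longlonglongrightarrow> 0"
      using lim snd_stereo_tendsto_iff_0[of "\<lambda>k. f k p"] by (simp only: )
  }
  {
    assume nz: "\<And>k. f k p \<noteq> 0" and "(\<lambda>k. inverse (f (r k) p)) \<longlonglongrightarrow> 0"
    then have "(\<lambda>k. - snd (stereo (Some (f (r k) p)))) \<longlonglongrightarrow> -1"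
      using snd_stereo_tendsto_iff_0[of "\<lambda>k. inverse (f (r k) p)"] snd_stereo_inverse[OF nz] by simp
    then have "- snd (stereo (g p)) = -1"
      by (rule LIMSEQ_unique[OF tendsto_minus[OF lim_r]])
    then have "(\<lambda>k. - snd (stereo (Some (f k p)))) \<longlonglongrightarrow> -1"
      using tendsto_minus[OF lim] by simp
    then show "(\<lambda>k. inverse (f k p)) \<longlonglongrightarrow> 0"
      using snd_stereo_tendsto_iff_0[of "\<lambda>k. inverse (f k p)"] snd_stereo_inverse[OF nz] by simp
  }
qed

text \<open>Pointwise convergence suffices because Schottky's theorem makes it locally
  uniform.\<close>

lemma sph_converges_to_0:
  assumes f: "\<And>k. omits01_on (f k) S" and S: "open S" and lim: "\<And>z. z \<in> S \<Longrightarrow> (\<lambda>k. f k z) \<longlonglongrightarrow> 0"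
  shows "sph_converges_to f S (\<lambda>_. Some 0)"
  unfolding sph_converges_to_def
proof
  fix z assume z: "z \<in> S"
  obtain r where r: "r > 0" "ball z r \<subseteq> S"
      "\<forall>q\<in>ball z r. (\<lambda>k. f k q) \<longlonglongrightarrow> 0 \<longrightarrow> uniform_limit (ball z r) f (\<lambda>_. 0) sequentially"
    using uniform_limit_0_of_tendsto_0[of f, OF f S z] by (elim exE conjE)
  have "uniform_limit (ball z r) f (\<lambda>_. 0) sequentially"
    using r(1) by (intro r(3)[rule_format, of z] lim z) simp
  from spherical_dist_Some_eventually_less[OF this] r(1,2)
  show "\<exists>r>0. ball z r \<subseteq> S \<and> (\<forall>e>0. \<forall>\<^sub>F k in sequentially. \<forall>w\<in>ball z r. spherical_dist (Some (f k w)) (Some 0) < e)"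
    by (intro exI[of _ r] conjI allI impI)
qed

lemma sph_converges_to_None:
  assumes f: "\<And>k. omits01_on (f k) S" and S: "open S" and lim: "\<And>z. z \<in> S \<Longrightarrow> (\<lambda>k. inverse (f k z)) \<longlonglongrightarrow> 0"
  shows "sph_converges_to f S (\<lambda>_. None)"
  unfolding sph_converges_to_def
proof
  fix z assume z: "z \<in> S"
  obtain r where r: "r > 0" "ball z r \<subseteq> S"
      "\<forall>q\<in>ball z r. (\<lambda>k. inverse (f k q)) \<longlonglongrightarrow> 0 \<longrightarrow>
        uniform_limit (ball z r) (\<lambda>k z. inverse (f k z)) (\<lambda>_. 0) sequentially"
    using uniform_limit_0_of_tendsto_0[of "\<lambda>k z. inverse (f k z)", OF omits01_on_inverse[OF f] S z]
    by (elim exE conjE)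
  have unif: "uniform_limit (ball z r) (\<lambda>k z. inverse (f k z)) (\<lambda>_. 0) sequentially"
    using r(1) by (intro r(3)[rule_format, of z] lim z) simp
  have nz: "f k w \<noteq> 0" if "w \<in> ball z r" for k w
    using f[of k] that r(2) by (auto simp: omits01_on_def)
  from spherical_dist_None_eventually_less[OF unif nz] r(1,2)
  show "\<exists>r>0. ball z r \<subseteq> S \<and> (\<forall>e>0. \<forall>\<^sub>F k in sequentially. \<forall>w\<in>ball z r. spherical_dist (Some (f k w)) None < e)"
    by (intro exI[of _ r] conjI allI impI)
qed

section \<open>Passage to subsequences\<close>

lemma uniform_limit_compose_affine:
  fixes f :: "nat \<Rightarrow> complex \<Rightarrow> complex"
  assumes lim: "uniform_limit (cball 0 t) (\<lambda>k w. f k (z0 + c * w)) g sequentially" and c: "c \<noteq> 0"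
  shows "uniform_limit (ball z0 (cmod c * t)) f (\<lambda>z. g ((z - z0) / c)) sequentially"
proof (rule uniform_limitI)
  fix e :: real assume "e > 0"
  with lim have "\<forall>\<^sub>F k in sequentially. \<forall>w\<in>cball 0 t. dist (f k (z0 + c * w)) (g w) < e"
    by (rule uniform_limitD)
  then show "\<forall>\<^sub>F k in sequentially. \<forall>z\<in>ball z0 (cmod c * t). dist (f k z) (g ((z - z0) / c)) < e"
  proof eventually_elim
    case (elim k)
    show ?case
    proof
      fix z assume "z \<in> ball z0 (cmod c * t)"
      then have "(z - z0) / c \<in> cball 0 t"
        using c by (simp add: dist_norm norm_divide norm_minus_commute field_simps)
      from bspec[OF elim this] show "dist (f k z) (g ((z - z0) / c)) < e"
        using c by simp
    qed
  qed
qed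

text \<open>An affine change of variable sends 0 to \<open>z0\<close> and the real line to the given
  line. Uniform convergence near 0 in the new variable would contradict \<open>nonconv\<close> in a
  small disc about \<open>z0\<close>.\<close>

lemma nonnormal_dichotomy:
  fixes f :: "nat \<Rightarrow> complex \<Rightarrow> complex"
  assumes D: "open D" and a: "a \<noteq> 0" and z0: "z0 \<in> D" "a \<bullet> z0 = b"
    and hol: "\<And>k. f k holomorphic_on D" and nz: "\<And>k z. z \<in> D \<Longrightarrow> f k z \<noteq> 0"
    and one: "\<And>k z. z \<in> D \<Longrightarrow> f k z = 1 \<Longrightarrow> a \<bullet> z = b"
    and nonconv: "\<And>U r. open U \<Longrightarrow> z0 \<in> U \<Longrightarrow> U \<subseteq> D \<Longrightarrow> strict_mono r \<Longrightarrow> \<not> sph_convergent (f \<circ> r) U"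
  obtains r :: "nat \<Rightarrow> nat" and z w where "strict_mono r" "z \<in> D" "a \<bullet> z \<noteq> b" "w \<in> D" "a \<bullet> w \<noteq> b"
    "(\<lambda>k. f (r k) z) \<longlonglongrightarrow> 0" "(\<lambda>k. inverse (f (r k) w)) \<longlonglongrightarrow> 0"
proof -
  obtain R where R: "R > 0" "ball z0 R \<subseteq> D"
    using D z0(1) openE by blast
  \<comment> \<open>The scale gives |c| = R/4, so that \<open>ball 0 4\<close> is mapped into
    \<open>ball z0 R\<close>.\<close>
  define s where "s = R / (4 * cmod a)"
  have s: "s > 0"
    using R a by (simp add: s_def)
  \<comment> \<open>Since \<open>a\<close> is normal to the line, -i a points along it. This makes
    \<open>a \<bullet> (c * w)\<close> a positive multiple of \<open>Im w\<close>.\<close>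
  define c where "c = - \<i> * a * of_real s"
  have "cmod c = cmod a * s"
    using s by (simp add: c_def norm_mult)
  then have c: "c \<noteq> 0" "cmod c = R / 4"
    using a s R by (auto simp: c_def s_def)
  have line: "a \<bullet> (z0 + c * w) = b \<longleftrightarrow> Im w = 0" for w
  proof -
    have "a \<bullet> (c * w) = s * (cmod a)\<^sup>2 * Im w"
      unfolding c_def cmod_power2 by (simp add: inner_complex_def power2_eq_square algebra_simps)
    then show ?thesis
      using s a z0(2) by (simp add: inner_add_right)
  qed
  have inD: "z0 + c * w \<in> D" if "w \<in> ball 0 4" for w
  proof -
    have "cmod (c * w) < R"
      using that c mult_strict_left_mono[of "cmod w" 4 "cmod c"] by (simp add: norm_mult)
    then show ?thesis
      using R by (auto simp: dist_norm)
  qed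
  define F where "F = (\<lambda>k w. f k (z0 + c * w))"
  have sub: "ball z0 (cmod c * (1/4)) \<subseteq> D"
    using R unfolding c(2) by (intro order_trans[OF subset_ball R(2)]) simp
  have z0_in: "z0 \<in> ball z0 (cmod c * (1/4))"
    using c R by simp
  have no_conv: "\<not> (\<forall>e>0. \<forall>\<^sub>F k in sequentially. \<forall>w\<in>ball z0 (cmod c * (1/4)). spherical_dist (Some (f (r k) w)) (g w) < e)"
    if "strict_mono r" for r g
  proof
    assume conv: "\<forall>e>0. \<forall>\<^sub>F k in sequentially. \<forall>w\<in>ball z0 (cmod c * (1/4)). spherical_dist (Some (f (r k) w)) (g w) < e"
    have "sph_converges_to (f \<circ> r) (ball z0 (cmod c * (1/4))) g"
      unfolding sph_converges_to_def
    proof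
      fix z assume "z \<in> ball z0 (cmod c * (1/4))"
      then obtain d where d: "d > 0" "ball z d \<subseteq> ball z0 (cmod c * (1/4))"
        using openE open_ball by blast
      have "\<forall>\<^sub>F k in sequentially. \<forall>w\<in>ball z d. spherical_dist (Some ((f \<circ> r) k w)) (g w) < e" if "e > 0" for e
        using conv[rule_format, OF that]
      proof eventually_elim
        case (elim k)
        then show ?case
          using d(2) by auto
      qed
      with d show "\<exists>d>0. ball z d \<subseteq> ball z0 (cmod c * (1/4)) \<and>
          (\<forall>e>0. \<forall>\<^sub>F k in sequentially. \<forall>w\<in>ball z d. spherical_dist (Some ((f \<circ> r) k w)) (g w) < e)"
        by (intro exI[of _ d] conjI allI impI)
    qed
    then have "sph_convergent (f \<circ> r) (ball z0 (cmod c * (1/4)))"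
      unfolding sph_convergent_def by (intro exI[of _ g])
    with nonconv[OF open_ball z0_in sub that] show False
      by (rule notE)
  qed
  show ?thesis
  proof (rule normalized_dichotomy[of F])
    fix k
    have "f k \<circ> (\<lambda>w. z0 + c * w) holomorphic_on ball 0 4"
      using inD by (intro holomorphic_on_compose_gen[OF _ hol] holomorphic_intros image_subsetI)
    then show "F k holomorphic_on ball 0 4"
      by (simp add: F_def o_def)
  next
    fix k w assume "w \<in> ball (0::complex) 4"
    then show "F k w \<noteq> 0"
      unfolding F_def by (intro nz inD)
  next
    fix k w assume w: "w \<in> ball (0::complex) 4" and "F k w = 1"
    then have "f k (z0 + c * w) = 1"
      by (simp add: F_def)
    then show "Im w = 0"
      using one[OF inD[OF w]] line by blast
  next
    fix r :: "nat \<Rightarrow> nat" and g assume r: "strict_mono r"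
    show "\<not> uniform_limit (cball 0 (1/4)) (F \<circ> r) g sequentially"
    proof
      assume "uniform_limit (cball 0 (1/4)) (F \<circ> r) g sequentially"
      then have "uniform_limit (cball 0 (1/4)) (\<lambda>k w. f (r k) (z0 + c * w)) g sequentially"
        by (simp add: F_def o_def)
      from uniform_limit_compose_affine[where f = "\<lambda>k. f (r k)", OF this c(1)]
      have "uniform_limit (ball z0 (cmod c * (1/4))) (\<lambda>k. f (r k)) (\<lambda>z. g ((z - z0) / c)) sequentially" .
      from spherical_dist_Some_eventually_less[OF this] show False
        using no_conv[OF r, of "\<lambda>z. Some (g ((z - z0) / c))"] by simp
    qed
  next
    fix r :: "nat \<Rightarrow> nat" assume r: "strict_mono r"
    show "\<not> uniform_limit (cball 0 (1/4)) (\<lambda>k w. inverse (F (r k) w)) (\<lambda>_. 0) sequentially"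
    proof
      assume "uniform_limit (cball 0 (1/4)) (\<lambda>k w. inverse (F (r k) w)) (\<lambda>_. 0) sequentially"
      then have "uniform_limit (cball 0 (1/4)) (\<lambda>k w. inverse (f (r k) (z0 + c * w))) (\<lambda>_. 0) sequentially"
        by (simp add: F_def)
      from uniform_limit_compose_affine[where f = "\<lambda>k z. inverse (f (r k) z)", OF this c(1)]
      have "uniform_limit (ball z0 (cmod c * (1/4))) (\<lambda>k z. inverse (f (r k) z)) (\<lambda>_. 0) sequentially" .
      from spherical_dist_None_eventually_less[OF this] show False
        using no_conv[OF r, of "\<lambda>_. None"] nz subsetD[OF sub] by simp
    qed
  next
    fix r :: "nat \<Rightarrow> nat" and z w
    assume rzw: "strict_mono r" "z \<in> ball 0 4" "Im z \<noteq> 0" "w \<in> ball 0 4" "Im w \<noteq> 0"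
      "(\<lambda>k. F (r k) z) \<longlonglongrightarrow> 0" "(\<lambda>k. inverse (F (r k) w)) \<longlonglongrightarrow> 0"
    show thesis
      using rzw line by (intro that[OF rzw(1) inD[OF rzw(2)] _ inD[OF rzw(4)]]) (simp_all add: F_def)
  qed
qed

section \<open>From points off the line to the two sides and the full sequence\<close>

lemma not_both_tendsto_0:
  fixes x :: "nat \<Rightarrow> complex"
  assumes "\<And>k. x k \<noteq> 0" "x \<longlonglongrightarrow> 0"
  shows "\<not> (\<lambda>k. inverse (x k)) \<longlonglongrightarrow> 0"
proof
  assume "(\<lambda>k. inverse (x k)) \<longlonglongrightarrow> 0"
  with assms(2) have "(\<lambda>k. x k * inverse (x k)) \<longlonglongrightarrow> 0 * 0"
    by (rule tendsto_mult)
  then show False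
    using assms(1) by (simp add: LIMSEQ_const_iff)
qed

text \<open>\<open>z\<close> and \<open>w\<close> cannot lie on the same side, because the limit 0
  would spread from \<open>z\<close> to \<open>w\<close>. So each side contains exactly one of them,
  and its limit spreads over that side.\<close>

lemma alternative_on_halves:
  fixes f :: "nat \<Rightarrow> complex \<Rightarrow> complex"
  assumes f: "\<And>k. omits01_on (f k) A" "\<And>k. omits01_on (f k) B"
    and A: "open A" "connected A" and B: "open B" "connected B"
    and z: "z \<in> A \<union> B" "(\<lambda>k. f k z) \<longlonglongrightarrow> 0" and w: "w \<in> A \<union> B" "(\<lambda>k. inverse (f k w)) \<longlonglongrightarrow> 0"
  shows "((\<forall>x\<in>A. (\<lambda>k. f k x) \<longlonglongrightarrow> 0) \<and> (\<forall>x\<in>B. (\<lambda>k. inverse (f k x)) \<longlonglongrightarrow> 0)) \<or>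
         ((\<forall>x\<in>A. (\<lambda>k. inverse (f k x)) \<longlonglongrightarrow> 0) \<and> (\<forall>x\<in>B. (\<lambda>k. f k x) \<longlonglongrightarrow> 0))"
proof -
  have separate: "False" if "\<And>k. omits01_on (f k) S" "open S" "connected S" "z \<in> S" "w \<in> S" for S
  proof -
    have "(\<lambda>k. f k w) \<longlonglongrightarrow> 0"
      using tendsto_0_propagates[of f, OF that(1-4) z(2) that(5)] .
    moreover have "f k w \<noteq> 0" for k
      using that(1)[of k] that(5) by (simp add: omits01_on_def)
    ultimately show False
      using not_both_tendsto_0[of "\<lambda>k. f k w"] w(2) by simp
  qed
  consider "z \<in> A" "w \<in> B" | "z \<in> B" "w \<in> A"
    using z(1) w(1) separate[OF f(1) A] separate[OF f(2) B] by blast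
  then show ?thesis
  proof cases
    case 1
    have "(\<lambda>k. f k x) \<longlonglongrightarrow> 0" if "x \<in> A" for x
      by (rule tendsto_0_propagates[of f, OF f(1) A 1(1) z(2) that])
    moreover have "(\<lambda>k. inverse (f k x)) \<longlonglongrightarrow> 0" if "x \<in> B" for x
      by (rule tendsto_0_propagates[of "\<lambda>k z. inverse (f k z)", OF omits01_on_inverse[OF f(2)] B 1(2) w(2) that])
    ultimately show ?thesis
      by simp
  next
    case 2
    have "(\<lambda>k. f k x) \<longlonglongrightarrow> 0" if "x \<in> B" for x
      by (rule tendsto_0_propagates[of f, OF f(2) B 2(1) z(2) that])
    moreover have "(\<lambda>k. inverse (f k x)) \<longlonglongrightarrow> 0" if "x \<in> A" for x
      by (rule tendsto_0_propagates[of "\<lambda>k z. inverse (f k z)", OF omits01_on_inverse[OF f(1)] A 2(2) w(2) that])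
    ultimately show ?thesis
      by simp
  qed
qed

lemma tendsto_0_of_subseq:
  fixes x :: "nat \<Rightarrow> complex"
  assumes "\<And>s :: nat \<Rightarrow> nat. strict_mono s \<Longrightarrow> \<exists>r :: nat \<Rightarrow> nat. (\<lambda>k. x (s (r k))) \<longlonglongrightarrow> 0"
  shows "x \<longlonglongrightarrow> 0"
proof (rule tendstoI, rule ccontr)
  fix e :: real assume e: "e > 0" and "\<not> (\<forall>\<^sub>F k in sequentially. dist (x k) 0 < e)"
  then obtain s :: "nat \<Rightarrow> nat" where s: "strict_mono s" "\<And>k. \<not> dist (x (s k)) 0 < e"
    using not_eventually_sequentiallyD by blast
  obtain r :: "nat \<Rightarrow> nat" where "(\<lambda>k. x (s (r k))) \<longlonglongrightarrow> 0"
    using assms[OF s(1)] by (elim exE)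
  from tendstoD[OF this e] have "\<forall>\<^sub>F k in sequentially. False"
    by (rule eventually_mono) (use s(2) in blast)
  then show False
    by simp
qed

theorem theorem1p3:
  fixes D Dplus Dminus L :: "complex set"
    and a :: complex and b :: real
    and F :: "(complex \<Rightarrow> complex) set"
    and f :: "nat \<Rightarrow> complex \<Rightarrow> complex"
    and z0 :: complex
  assumes "plane_domain D"
    and "a \<noteq> 0" and "L = {z. a \<bullet> z = b}"
    and "plane_domain Dplus" and "plane_domain Dminus"
    and "D - L = Dplus \<union> Dminus" and "Dplus \<inter> Dminus = {}"
    and "Dplus \<subseteq> {z. a \<bullet> z > b}" and "Dminus \<subseteq> {z. a \<bullet> z < b}"
    and "\<And>h. h \<in> F \<Longrightarrow> h holomorphic_on D"
    and "\<And>h z. h \<in> F \<Longrightarrow> z \<in> D \<Longrightarrow> h z \<noteq> 0"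
    and "\<And>h z. h \<in> F \<Longrightarrow> z \<in> D \<Longrightarrow> h z = 1 \<Longrightarrow> z \<in> L"
    and "z0 \<in> D \<inter> L"
    and "\<not> normal_at D F z0"
    and "\<And>k. f k \<in> F"
    and "\<not> (\<exists>U (r :: nat \<Rightarrow> nat). open U \<and> z0 \<in> U \<and> U \<subseteq> D \<and> strict_mono r \<and> sph_convergent (f \<circ> r) U)"
    and "sph_convergent f Dplus"
  shows "(sph_converges_to f Dplus (\<lambda>_. Some 0) \<and> sph_converges_to f Dminus (\<lambda>_. None)) \<or>
         (sph_converges_to f Dplus (\<lambda>_. None) \<and> sph_converges_to f Dminus (\<lambda>_. Some 0))"
proof -
  have D: "open D" and P: "open Dplus" "connected Dplus" "Dplus \<noteq> {}" and N: "open Dminus" "connected Dminus"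
    using assms(1,4,5) by (auto simp: plane_domain_def)
  have hol: "f k holomorphic_on D" for k
    using assms(10,15) by blast
  have nz: "f k z \<noteq> 0" if "z \<in> D" for k z
    using assms(11)[OF assms(15) that] .
  have one: "a \<bullet> z = b" if "z \<in> D" "f k z = 1" for k z
    using assms(12)[OF assms(15) that] assms(3) by simp
  have omit: "omits01_on (f k) (D - L)" for k
    unfolding omits01_on_def
    using holomorphic_on_subset[OF hol Diff_subset] nz assms(12)[OF assms(15)] by blast
  have omitP: "omits01_on (f k) Dplus" and omitN: "omits01_on (f k) Dminus" for k
    using omit[of k] unfolding assms(6) by (auto elim: omits01_on_subset)
  \<comment> \<open>The absence of convergent subsequences near \<open>z0\<close> is inherited by
    every subsequence \<open>s\<close>, so one of the two alternatives holds along a further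
    subsequence. At this stage which one may depend on \<open>s\<close>.\<close>
  have alt: "\<exists>r. strict_mono r \<and>
      (((\<forall>x\<in>Dplus. (\<lambda>k. f (s (r k)) x) \<longlonglongrightarrow> 0) \<and> (\<forall>x\<in>Dminus. (\<lambda>k. inverse (f (s (r k)) x)) \<longlonglongrightarrow> 0)) \<or>
       ((\<forall>x\<in>Dplus. (\<lambda>k. inverse (f (s (r k)) x)) \<longlonglongrightarrow> 0) \<and> (\<forall>x\<in>Dminus. (\<lambda>k. f (s (r k)) x) \<longlonglongrightarrow> 0)))"
    if s: "strict_mono s" for s :: "nat \<Rightarrow> nat"
  proof (rule nonnormal_dichotomy[of D a z0 b "\<lambda>k. f (s k)"])
    show "z0 \<in> D" "a \<bullet> z0 = b"
      using assms(3,13) by auto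
    show "a \<bullet> z = b" if "z \<in> D" "f (s k) z = 1" for k z
      using one that .
    show "\<not> sph_convergent ((\<lambda>k. f (s k)) \<circ> r) U"
      if U: "open U" "z0 \<in> U" "U \<subseteq> D" "strict_mono r" for U and r :: "nat \<Rightarrow> nat"
    proof
      assume "sph_convergent ((\<lambda>k. f (s k)) \<circ> r) U"
      then have "sph_convergent (f \<circ> (s \<circ> r)) U"
        by (simp add: o_def)
      then show False
        using assms(16) U strict_mono_o[OF s U(4)] by blast
    qed
  next
    fix r :: "nat \<Rightarrow> nat" and z w
    assume rzw: "strict_mono r" "z \<in> D" "a \<bullet> z \<noteq> b" "w \<in> D" "a \<bullet> w \<noteq> b"
      "(\<lambda>k. f (s (r k)) z) \<longlonglongrightarrow> 0" "(\<lambda>k. inverse (f (s (r k)) w)) \<longlonglongrightarrow> 0"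
    have zw: "z \<in> Dplus \<union> Dminus" "w \<in> Dplus \<union> Dminus"
      using rzw(2-5) unfolding assms(6)[symmetric] assms(3) by auto
    show ?thesis
      using rzw(1) alternative_on_halves[where f = "\<lambda>k. f (s (r k))", OF omitP omitN P(1,2) N zw(1) rzw(6) zw(2) rzw(7)]
      by (intro exI[of _ r] conjI)
  qed (use D assms(2) hol nz in auto)
  \<comment> \<open>Convergence on \<open>Dplus\<close> removes this dependence: the full sequence
    has a limit at \<open>p\<close>, and that limit selects the same alternative along every
    subsequence.\<close>
  obtain g where g: "sph_converges_to f Dplus g"
    using assms(17) unfolding sph_convergent_def by (elim exE)
  obtain p where p: "p \<in> Dplus"
    using P(3) by blast
  have nzP: "f k p \<noteq> 0" for k
    using omitP[of k] p by (simp add: omits01_on_def)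
  obtain r where r: "strict_mono r" and r_alt:
      "((\<forall>x\<in>Dplus. (\<lambda>k. f (r k) x) \<longlonglongrightarrow> 0) \<and> (\<forall>x\<in>Dminus. (\<lambda>k. inverse (f (r k) x)) \<longlonglongrightarrow> 0)) \<or>
       ((\<forall>x\<in>Dplus. (\<lambda>k. inverse (f (r k) x)) \<longlonglongrightarrow> 0) \<and> (\<forall>x\<in>Dminus. (\<lambda>k. f (r k) x) \<longlonglongrightarrow> 0))"
    using alt[OF strict_mono_id] unfolding id_apply by (elim exE conjE)
  have excl: "\<not> ((\<lambda>k. f (s k) p) \<longlonglongrightarrow> 0 \<and> (\<lambda>k. inverse (f (s k) p)) \<longlonglongrightarrow> 0)" for s
    using not_both_tendsto_0[of "\<lambda>k. f (s k) p"] nzP by blast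
  from r_alt show ?thesis
  proof
    assume "(\<forall>x\<in>Dplus. (\<lambda>k. f (r k) x) \<longlonglongrightarrow> 0) \<and> (\<forall>x\<in>Dminus. (\<lambda>k. inverse (f (r k) x)) \<longlonglongrightarrow> 0)"
    then have fp: "(\<lambda>k. f k p) \<longlonglongrightarrow> 0"
      using sph_converges_imp_tendsto_0(1)[OF g p r] p by simp
    \<comment> \<open>No convergence on \<open>Dminus\<close> is assumed. Every subsequence has a
      further one satisfying one of the alternatives, and the limit 0 at \<open>p\<close> excludes
      the wrong one, so the full sequence converges at \<open>q\<close>.\<close>
    have "(\<lambda>k. inverse (f k q)) \<longlonglongrightarrow> 0" if q: "q \<in> Dminus" for q
    proof (rule tendsto_0_of_subseq)
      fix s :: "nat \<Rightarrow> nat" assume s: "strict_mono s"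
      obtain t where t: "strict_mono t" and t_alt:
          "((\<forall>x\<in>Dplus. (\<lambda>k. f (s (t k)) x) \<longlonglongrightarrow> 0) \<and> (\<forall>x\<in>Dminus. (\<lambda>k. inverse (f (s (t k)) x)) \<longlonglongrightarrow> 0)) \<or>
           ((\<forall>x\<in>Dplus. (\<lambda>k. inverse (f (s (t k)) x)) \<longlonglongrightarrow> 0) \<and> (\<forall>x\<in>Dminus. (\<lambda>k. f (s (t k)) x) \<longlonglongrightarrow> 0))"
        using alt[OF s] by (elim exE conjE)
      have "(\<lambda>k. f (s (t k)) p) \<longlonglongrightarrow> 0"
        using LIMSEQ_subseq_LIMSEQ[OF fp strict_mono_o[OF s t]] by (simp add: o_def)
      then have "(\<lambda>k. inverse (f (s (t k)) q)) \<longlonglongrightarrow> 0"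
        using t_alt excl[of "\<lambda>k. s (t k)"] p q by auto
      then show "\<exists>r. (\<lambda>k. inverse (f (s (r k)) q)) \<longlonglongrightarrow> 0"
        by (intro exI[of _ t])
    qed
    then have "sph_converges_to f Dminus (\<lambda>_. None)"
      by (intro sph_converges_to_None omitN N(1))
    moreover have "(\<lambda>k. f k x) \<longlonglongrightarrow> 0" if "x \<in> Dplus" for x
      by (rule tendsto_0_propagates[of f, OF omitP P(1,2) p fp that])
    then have "sph_converges_to f Dplus (\<lambda>_. Some 0)"
      by (intro sph_converges_to_0 omitP P(1))
    ultimately show ?thesis
      by simp
  next
    assume "(\<forall>x\<in>Dplus. (\<lambda>k. inverse (f (r k) x)) \<longlonglongrightarrow> 0) \<and> (\<forall>x\<in>Dminus. (\<lambda>k. f (r k) x) \<longlonglongrightarrow> 0)"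
    then have fp: "(\<lambda>k. inverse (f k p)) \<longlonglongrightarrow> 0"
      using sph_converges_imp_tendsto_0(2)[OF g p r nzP] p by simp
    have "(\<lambda>k. f k q) \<longlonglongrightarrow> 0" if q: "q \<in> Dminus" for q
    proof (rule tendsto_0_of_subseq)
      fix s :: "nat \<Rightarrow> nat" assume s: "strict_mono s"
      obtain t where t: "strict_mono t" and t_alt:
          "((\<forall>x\<in>Dplus. (\<lambda>k. f (s (t k)) x) \<longlonglongrightarrow> 0) \<and> (\<forall>x\<in>Dminus. (\<lambda>k. inverse (f (s (t k)) x)) \<longlonglongrightarrow> 0)) \<or>
           ((\<forall>x\<in>Dplus. (\<lambda>k. inverse (f (s (t k)) x)) \<longlonglongrightarrow> 0) \<and> (\<forall>x\<in>Dminus. (\<lambda>k. f (s (t k)) x) \<longlonglongrightarrow> 0))"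
        using alt[OF s] by (elim exE conjE)
      have "(\<lambda>k. inverse (f (s (t k)) p)) \<longlonglongrightarrow> 0"
        using LIMSEQ_subseq_LIMSEQ[OF fp strict_mono_o[OF s t]] by (simp add: o_def)
      then have "(\<lambda>k. f (s (t k)) q) \<longlonglongrightarrow> 0"
        using t_alt excl[of "\<lambda>k. s (t k)"] p q by auto
      then show "\<exists>r. (\<lambda>k. f (s (r k)) q) \<longlonglongrightarrow> 0"
        by (intro exI[of _ t])
    qed
    then have "sph_converges_to f Dminus (\<lambda>_. Some 0)"
      by (intro sph_converges_to_0 omitN N(1))
    moreover have "(\<lambda>k. inverse (f k x)) \<longlonglongrightarrow> 0" if "x \<in> Dplus" for x
      by (rule tendsto_0_propagates[of "\<lambda>k z. inverse (f k z)", OF omits01_on_inverse[OF omitP] P(1,2) p fp that])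
    then have "sph_converges_to f Dplus (\<lambda>_. None)"
      by (intro sph_converges_to_None omitP P(1))
    ultimately show ?thesis
      by simp
  qed
qed

end
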